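(* Let $(\mathcal X,d,\mu)$ be a space of homogeneous type, $\beta,\gamma\in(0,\eta)$ and $s\in(0,\beta\wedge\gamma)$. Then $C^s(\mathcal X)=B^s_{\infty,\infty}(\mathcal X)$ in the following sense: (i) there exists a positive constant $C$ such that, for any $f\in C^s(\mathcal X)$, $\|f\|_{B^s_{\infty,\infty}(\mathcal X)}\le C\|f\|_{C^s(\mathcal X)}$; (ii) for any $f\in B^s_{\infty,\infty}(\mathcal X)$, there exists a $g\in C^s(\mathcal X)$ such that $f=g$ in $(\mathcal G^\eta_0(\beta,\gamma))'$ and $\|g\|_{C^s(\mathcal X)}\le C\|f\|_{B^s_{\infty,\infty}(\mathcal X)}$, where $C$ is a positive constant independent of $f$.
   Context: Space. $d$ is a quasi-metric on $\mathcal X$: $d\ge0$, $d(x,y)=0$ iff $x=y$, $d$ symmetric, $d(x,z)\le A_0[d(x,y)+d(y,z)]$ for some $A_0\in[1,\infty)$. $B(x,r):=\{y:d(x,y)<r\}$. $(\mathcal X,d,\mu)$ is a space of homogeneous type: $\mu$ is a measure for which balls are measurable with $0<\mu(B)<\infty$, and $\mu(2B)\le C_{(\mu)}\mu(B)$ for every ball $B$. $\mu(\mathcal X)$ may be finite or infinite. $V_r(x):=\mu(B(x,r))$, $V(x,y):=\mu(B(x,d(x,y)))$ ($=0$ if $x=y$). $a\wedge b:=\min\{a,b\}$. $m_E(g):=\frac1{\mu(E)}\int_Eg\,d\mu$. $\mathbb Z_+=\{0,1,2,\dots\}$, $\mathbb N=\{1,2,\dots\}$. Dyadic cubes. Fix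 $0<c_0\le C_0<\infty$, a small $\delta\in(0,1)$ (e.g. $\delta\le(2A_0)^{-10}$) with $12A_0^3C_0\delta\le c_0$, and points $\{z^k_\alpha:k\in\mathbb Z,\alpha\in\mathcal A_k\}$, nested ($\mathcal A_k\subset\mathcal A_{k+1}$ and $z^{k+1}_\alpha=z^k_\alpha$ for $\alpha\in\mathcal A_k$), with $d(z^k_\alpha,z^k_\beta)\ge c_0\delta^k$ if $\alpha\ne\beta$ and $\min_{\alpha\in\mathcal A_k}d(x,z^k_\alpha)<C_0\delta^k$ for all $x$. $\mathcal Y^k:=\{z^{k+1}_\alpha:\alpha\in\mathcal A_{k+1}\setminus\mathcal A_k\}$, $d(x,\mathcal Y^k):=\inf_{y\in\mathcal Y^k}d(x,y)$. $\{Q^k_\alpha\}$ is an associated (Hytönen–Kairema) system of dyadic cubes: for each $k$, $\{Q^k_\alpha\}_{\alpha\in\mathcal A_k}$ is disjoint with union $\mathcal X$; for $k\le l$ each $Q^l_\beta$ is contained in or disjoint from each $Q^k_\alpha$; $B(z^k_\alpha,(3A_0^2)^{-1}c_0\delta^k)\subset Q^k_\alpha\subset B(z^k_\alpha,2A_0C_0\delta^k)$. Fix $j_0\in\mathbb N$ large with $\delta^{j_0}\le(2A_0)^{-3}C_0$; $\{Q^{k,m}_\alpha\}_{m=1}^{N(k,\alpha)}$ enumerates the cubes $Q^{k+j_0}_\tau$ contained in $Q^k_\alpha$. exp-IATI. $\eta\in(0,1)$ is a fixed exponent for which such approximations exist on $\mathcal X$. Put $$E_k(x,y):=\frac{1}{\sqrt{V_{\delta^k}(x)V_{\delta^k}(y)}}\exp\Big\{-\nu\Big[\frac{d(x,y)}{\delta^k}\Big]^a\Big\}\exp\Big\{-\nu\Big[\frac{\max\{d(x,\mathcal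 Y^k),d(y,\mathcal Y^k)\}}{\delta^k}\Big]^a\Big\}.$$ An exp-IATI is a sequence $\{Q_k\}_{k\in\mathbb Z_+}$ of bounded linear integral operators on $L^2(\mathcal X)$, with kernels $Q_k(x,y)$, with $\sum_{k=0}^\infty Q_k=I$ in $L^2(\mathcal X)$, such that for some constants $C,\nu\in(0,\infty)$, $a\in(0,1]$, for all $k\in\mathbb N$ and all points: (a) $|Q_k(x,y)|\le CE_k(x,y)$; (b) if $d(x,x')\le\delta^k$, then $|Q_k(x,y)-Q_k(x',y)|+|Q_k(y,x)-Q_k(y,x')|\le C[d(x,x')/\delta^k]^\eta E_k(x,y)$; (c) if $d(x,x')\le\delta^k$ and $d(y,y')\le\delta^k$, then $|[Q_k(x,y)-Q_k(x',y)]-[Q_k(x,y')-Q_k(x',y')]|\le C[d(x,x')/\delta^k]^\eta[d(y,y')/\delta^k]^\eta E_k(x,y)$; (d) $\int Q_k(x,y)\,d\mu(y)=0=\int Q_k(y,x)\,d\mu(y)$; while $Q_0$ satisfies (a)–(c) with $k=0$ and with the second exponential factor removed from $E_0$, and $\int Q_0(x,y)\,d\mu(y)=1=\int Q_0(y,x)\,d\mu(y)$. Test functions and distributions. Fix $x_0\in\mathcal X$. For $\beta\in(0,1]$, $\gamma\in(0,\infty)$, $\mathcal G(\beta,\gamma)$ is the set of functions $f$ for which there is $C>0$ such that, with $D_\gamma(x):=\frac{1}{V_1(x_0)+V(x_0,x)}[1+d(x_0,x)]^{-\gamma}$: $|f(x)|\le CD_\gamma(x)$ for all $x$, and $|f(x)-f(y)|\le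 C[\frac{d(x,y)}{1+d(x_0,x)}]^\beta D_\gamma(x)$ whenever $d(x,y)\le(2A_0)^{-1}[1+d(x_0,x)]$; its norm is the infimum of such $C$. For $\beta,\gamma\in(0,\eta]$, $\mathcal G^\eta_0(\beta,\gamma)$ is the completion of $\mathcal G(\eta,\eta)$ in $\mathcal G(\beta,\gamma)$, and $(\mathcal G^\eta_0(\beta,\gamma))'$ is its dual. For $f$ in this dual, $Q_k(f)(x)=Q_kf(x):=\langle f,Q_k(x,\cdot)\rangle$; functions act as distributions by integration. The integer $N$. With an exp-IATI $\{Q_k\}$ one associates a fixed $N\in\mathbb N$ for which the following (known) reproducing formula holds: for $\beta,\gamma\in(0,\eta)$ and arbitrary points $y^{k,m}_\alpha\in Q^{k,m}_\alpha$ there are bounded linear integral operators $\{\widetilde Q_k\}_{k\in\mathbb Z_+}$ on $L^2(\mathcal X)$ with, for all $f\in(\mathcal G^\eta_0(\beta,\gamma))'$, $$f=\sum_{\alpha\in\mathcal A_0}\sum_m\int_{Q^{0,m}_\alpha}\widetilde Q_0(\cdot,y)\,d\mu(y)\,Q^{0,m}_{\alpha,1}(f)+\sum_{k=1}^N\sum_{\alpha,m}\mu(Q^{k,m}_\alpha)\widetilde Q_k(\cdot,y^{k,m}_\alpha)Q^{k,m}_{\alpha,1}(f)+\sum_{k=N+1}^\infty\sum_{\alpha,m}\mu(Q^{k,m}_\alpha)\widetilde Q_k(\cdot,y^{k,m}_\alpha)Q_kf(y^{k,m}_\alpha)$$ in $(\mathcal G^\eta_0(\beta,\gamma))'$, where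 $Q^{k,m}_{\alpha,1}(f):=m_{Q^{k,m}_\alpha}(Q_kf)$ and, with $R_k(x,y):=\frac{1}{V_{\delta^k}(x)+V(x,y)}[\frac{\delta^k}{\delta^k+d(x,y)}]^\gamma$ and $C$ independent of the points $y^{k,m}_\alpha$: $|\widetilde Q_k(x,y)|\le CR_k(x,y)$; $|\widetilde Q_k(x,y)-\widetilde Q_k(x',y)|\le C[\frac{d(x,x')}{\delta^k+d(x,y)}]^\beta R_k(x,y)$ if $d(x,x')\le(2A_0)^{-1}[\delta^k+d(x,y)]$; $\int\widetilde Q_k(x,y)\,d\mu(y)=\int\widetilde Q_k(y,x)\,d\mu(y)$ equals $1$ if $k\le N$ and $0$ if $k>N$. Spaces. Fix an exp-IATI $\{Q_k\}_{k\in\mathbb Z_+}$ and its $N$. $B^s_{\infty,\infty}(\mathcal X)$ is the set of $f\in(\mathcal G^\eta_0(\beta,\gamma))'$ with $\|f\|_{B^s_{\infty,\infty}(\mathcal X)}:=\sup_{0\le k\le N}\sup_{\alpha\in\mathcal A_k}\sup_{1\le m\le N(k,\alpha)}m_{Q^{k,m}_\alpha}(|Q_k(f)|)+\sup_{k>N}\delta^{-ks}\|Q_k(f)\|_{L^\infty(\mathcal X)}<\infty$. $C^s(\mathcal X)$ is the set of continuous functions $f$ on $\mathcal X$ with $\|f\|_{C^s(\mathcal X)}:=\sup_{x\ne y}\frac{|f(x)-f(y)|}{[d(x,y)]^s}+\|f\|_{L^\infty(\mathcal X)}<\infty$. *)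

theory Defs
  imports "HOL-Analysis.Analysis" "HOL-Probability.Essential_Supremum"
begin

text \<open>All functions, kernels and functionals are complex-valued. The underlying set of the
  space is the whole type \<^typ>\<open>'a\<close>.\<close>

section \<open>Spaces of homogeneous type\<close>

definition quasi_metric :: "('a \<Rightarrow> 'a \<Rightarrow> real) \<Rightarrow> real \<Rightarrow> bool" where
  "quasi_metric d A0 \<longleftrightarrow>
     1 \<le> A0 \<and> (\<forall>x y. 0 \<le> d x y) \<and> (\<forall>x y. d x y = 0 \<longleftrightarrow> x = y) \<and> (\<forall>x y. d x y = d y x) \<and>
     (\<forall>x y z. d x z \<le> A0 * (d x y + d y z))"

definition qball :: "('a \<Rightarrow> 'a \<Rightarrow> real) \<Rightarrow> 'a \<Rightarrow> real \<Rightarrow> 'a set" where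
  "qball d x r = {y. d x y < r}"

definition homogeneous_type :: "('a \<Rightarrow> 'a \<Rightarrow> real) \<Rightarrow> real \<Rightarrow> 'a measure \<Rightarrow> bool" where
  "homogeneous_type d A0 \<mu> \<longleftrightarrow>
     quasi_metric d A0 \<and> space \<mu> = UNIV \<and>
     (\<forall>x. \<forall>r>0. qball d x r \<in> sets \<mu> \<and> 0 < emeasure \<mu> (qball d x r) \<and>
        emeasure \<mu> (qball d x r) < \<infinity>) \<and>
     (\<exists>C. \<forall>x. \<forall>r>0. measure \<mu> (qball d x (2 * r)) \<le> C * measure \<mu> (qball d x r))"

definition vol :: "('a \<Rightarrow> 'a \<Rightarrow> real) \<Rightarrow> 'a measure \<Rightarrow> real \<Rightarrow> 'a \<Rightarrow> real" where
  "vol d \<mu> r x = measure \<mu> (qball d x r)"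

text \<open>The quasi-metric topology; quasi-metric balls need not be open in it.\<close>

definition qtopology :: "('a \<Rightarrow> 'a \<Rightarrow> real) \<Rightarrow> 'a topology" where
  "qtopology d = topology (\<lambda>U. \<forall>x\<in>U. \<exists>r>0. qball d x r \<subseteq> U)"

lemma openin_qtopology: "openin (qtopology d) U \<longleftrightarrow> (\<forall>x\<in>U. \<exists>r>0. qball d x r \<subseteq> U)"
proof -
  have "istopology (\<lambda>U. \<forall>x\<in>U. \<exists>r>0. qball d x r \<subseteq> U)"
    unfolding istopology_def
  proof (intro conjI allI impI ballI)
    fix S T x
    assume S: "\<forall>x\<in>S. \<exists>r>0. qball d x r \<subseteq> S" and T: "\<forall>x\<in>T. \<exists>r>0. qball d x r \<subseteq> T"
      and x: "x \<in> S \<inter> T"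
    obtain r1 r2 where "r1 > 0" "qball d x r1 \<subseteq> S" "r2 > 0" "qball d x r2 \<subseteq> T"
      using S T x by blast
    then show "\<exists>r>0. qball d x r \<subseteq> S \<inter> T"
      by (intro exI[of _ "min r1 r2"]) (auto simp: qball_def)
  next
    fix \<K> x
    assume "\<forall>K\<in>\<K>. \<forall>x\<in>K. \<exists>r>0. qball d x r \<subseteq> K" "x \<in> \<Union>\<K>"
    then show "\<exists>r>0. qball d x r \<subseteq> \<Union>\<K>"
      by (meson UnionE Union_upper order_trans)
  qed
  then show ?thesis
    by (simp add: qtopology_def topology_inverse')
qed

section \<open>Dyadic cubes\<close>

definition dyadic_points ::
  "('a \<Rightarrow> 'a \<Rightarrow> real) \<Rightarrow> real \<Rightarrow> real \<Rightarrow> real \<Rightarrow> real \<Rightarrow> (int \<Rightarrow> 'i set) \<Rightarrow> (int \<Rightarrow> 'i \<Rightarrow> 'a) \<Rightarrow> bool" where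
  "dyadic_points d A0 c0 C0 \<delta> \<A> z \<longleftrightarrow>
     0 < c0 \<and> c0 \<le> C0 \<and> 0 < \<delta> \<and> \<delta> < 1 \<and> 12 * A0 ^ 3 * C0 * \<delta> \<le> c0 \<and>
     (\<forall>k. \<A> k \<subseteq> \<A> (k + 1)) \<and> (\<forall>k. \<forall>\<alpha>\<in>\<A> k. z (k + 1) \<alpha> = z k \<alpha>) \<and>
     (\<forall>k. \<forall>\<alpha>\<in>\<A> k. \<forall>\<beta>\<in>\<A> k. \<alpha> \<noteq> \<beta> \<longrightarrow> c0 * \<delta> powi k \<le> d (z k \<alpha>) (z k \<beta>)) \<and>
     (\<forall>k x. \<exists>\<alpha>\<in>\<A> k. d x (z k \<alpha>) < C0 * \<delta> powi k)"

text \<open>Measurability of the cubes (they are Borel sets in the construction of Hytonen and Kairema)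
  is needed for the averages over cubes to make sense, so it is part of the notion.\<close>

definition dyadic_cubes ::
  "('a \<Rightarrow> 'a \<Rightarrow> real) \<Rightarrow> real \<Rightarrow> 'a measure \<Rightarrow> real \<Rightarrow> real \<Rightarrow> real \<Rightarrow>
   (int \<Rightarrow> 'i set) \<Rightarrow> (int \<Rightarrow> 'i \<Rightarrow> 'a) \<Rightarrow> (int \<Rightarrow> 'i \<Rightarrow> 'a set) \<Rightarrow> bool" where
  "dyadic_cubes d A0 \<mu> c0 C0 \<delta> \<A> z Q \<longleftrightarrow>
     (\<forall>k. \<forall>\<alpha>\<in>\<A> k. Q k \<alpha> \<in> sets \<mu>) \<and>
     (\<forall>k. disjoint_family_on (Q k) (\<A> k) \<and> (\<Union>\<alpha>\<in>\<A> k. Q k \<alpha>) = UNIV) \<and>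
     (\<forall>k l. k \<le> l \<longrightarrow> (\<forall>\<alpha>\<in>\<A> k. \<forall>\<beta>\<in>\<A> l. Q l \<beta> \<subseteq> Q k \<alpha> \<or> Q l \<beta> \<inter> Q k \<alpha> = {})) \<and>
     (\<forall>k. \<forall>\<alpha>\<in>\<A> k. qball d (z k \<alpha>) (c0 * \<delta> powi k / (3 * A0\<^sup>2)) \<subseteq> Q k \<alpha> \<and>
        Q k \<alpha> \<subseteq> qball d (z k \<alpha>) (2 * A0 * C0 * \<delta> powi k))"

definition new_points :: "(int \<Rightarrow> 'i set) \<Rightarrow> (int \<Rightarrow> 'i \<Rightarrow> 'a) \<Rightarrow> int \<Rightarrow> 'a set" where
  "new_points \<A> z k = z (k + 1) ` (\<A> (k + 1) - \<A> k)"

text \<open>The subcubes $Q^{k,m}_\alpha$ of $Q^k_\alpha$ are indexed by the $\tau$ with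
  $Q^{k,m}_\alpha = Q^{k+j_0}_\tau$ instead of by their position $m$ in an enumeration.\<close>

definition subcubes ::
  "(int \<Rightarrow> 'i set) \<Rightarrow> (int \<Rightarrow> 'i \<Rightarrow> 'a set) \<Rightarrow> nat \<Rightarrow> nat \<Rightarrow> 'i \<Rightarrow> 'i set" where
  "subcubes \<A> Q j0 k \<alpha> = {\<tau> \<in> \<A> (int (k + j0)). Q (int (k + j0)) \<tau> \<subseteq> Q (int k) \<alpha>}"

section \<open>Integral operators and exp-IATIs\<close>

definition L2 :: "'a measure \<Rightarrow> ('a \<Rightarrow> complex) set" where
  "L2 \<mu> = {f \<in> borel_measurable \<mu>. integrable \<mu> (\<lambda>x. (cmod (f x))\<^sup>2)}"

definition L2_norm :: "'a measure \<Rightarrow> ('a \<Rightarrow> complex) \<Rightarrow> real" where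
  "L2_norm \<mu> f = sqrt (\<integral>x. (cmod (f x))\<^sup>2 \<partial>\<mu>)"

definition int_op :: "'a measure \<Rightarrow> ('a \<Rightarrow> 'a \<Rightarrow> complex) \<Rightarrow> ('a \<Rightarrow> complex) \<Rightarrow> 'a \<Rightarrow> complex" where
  "int_op \<mu> K f x = (\<integral>y. K x y * f y \<partial>\<mu>)"

definition bounded_L2_kernel :: "'a measure \<Rightarrow> ('a \<Rightarrow> 'a \<Rightarrow> complex) \<Rightarrow> bool" where
  "bounded_L2_kernel \<mu> K \<longleftrightarrow>
     case_prod K \<in> borel_measurable (\<mu> \<Otimes>\<^sub>M \<mu>) \<and>
     (\<exists>C. \<forall>f\<in>L2 \<mu>. (AE x in \<mu>. integrable \<mu> (\<lambda>y. K x y * f y)) \<and>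
        int_op \<mu> K f \<in> L2 \<mu> \<and> L2_norm \<mu> (int_op \<mu> K f) \<le> C * L2_norm \<mu> f)"

definition exp_size ::
  "('a \<Rightarrow> 'a \<Rightarrow> real) \<Rightarrow> 'a measure \<Rightarrow> real \<Rightarrow> real \<Rightarrow> real \<Rightarrow> nat \<Rightarrow> 'a \<Rightarrow> 'a \<Rightarrow> real" where
  "exp_size d \<mu> \<delta> \<nu> a k x y =
     1 / sqrt (vol d \<mu> (\<delta> ^ k) x * vol d \<mu> (\<delta> ^ k) y) * exp (- \<nu> * (d x y / \<delta> ^ k) powr a)"

text \<open>The distance to an empty set is $\infty$, so that this factor then vanishes.\<close>

definition exp_gap ::
  "('a \<Rightarrow> 'a \<Rightarrow> real) \<Rightarrow> real \<Rightarrow> 'a set \<Rightarrow> real \<Rightarrow> real \<Rightarrow> nat \<Rightarrow> 'a \<Rightarrow> 'a \<Rightarrow> real" where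
  "exp_gap d \<delta> Y \<nu> a k x y =
     (if Y = {} then 0
      else exp (- \<nu> * (max (INF w\<in>Y. d x w) (INF w\<in>Y. d y w) / \<delta> ^ k) powr a))"

definition kernel_estimates ::
  "('a \<Rightarrow> 'a \<Rightarrow> real) \<Rightarrow> real \<Rightarrow> real \<Rightarrow> ('a \<Rightarrow> 'a \<Rightarrow> real) \<Rightarrow> ('a \<Rightarrow> 'a \<Rightarrow> complex) \<Rightarrow> bool" where
  "kernel_estimates d r \<eta> E K \<longleftrightarrow>
     (\<forall>x y. cmod (K x y) \<le> E x y) \<and>
     (\<forall>x x' y. d x x' \<le> r \<longrightarrow>
        cmod (K x y - K x' y) + cmod (K y x - K y x') \<le> (d x x' / r) powr \<eta> * E x y) \<and>
     (\<forall>x x' y y'. d x x' \<le> r \<and> d y y' \<le> r \<longrightarrow>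
        cmod ((K x y - K x' y) - (K x y' - K x' y'))
          \<le> (d x x' / r) powr \<eta> * (d y y' / r) powr \<eta> * E x y)"

definition exp_IATI ::
  "('a \<Rightarrow> 'a \<Rightarrow> real) \<Rightarrow> 'a measure \<Rightarrow> real \<Rightarrow> (int \<Rightarrow> 'i set) \<Rightarrow> (int \<Rightarrow> 'i \<Rightarrow> 'a) \<Rightarrow> real \<Rightarrow>
   (nat \<Rightarrow> 'a \<Rightarrow> 'a \<Rightarrow> complex) \<Rightarrow> bool" where
  "exp_IATI d \<mu> \<delta> \<A> z \<eta> K \<longleftrightarrow>
     (\<forall>k. bounded_L2_kernel \<mu> (K k)) \<and>
     (\<forall>f\<in>L2 \<mu>. (\<lambda>n. L2_norm \<mu> (\<lambda>x. (\<Sum>k<n. int_op \<mu> (K k) f x) - f x)) \<longlonglongrightarrow> 0) \<and>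
     (\<exists>C>0. \<exists>\<nu>>0. \<exists>a\<in>{0<..1}.
        kernel_estimates d 1 \<eta> (\<lambda>x y. C * exp_size d \<mu> \<delta> \<nu> a 0 x y) (K 0) \<and>
        (\<forall>k\<ge>1. kernel_estimates d (\<delta> ^ k) \<eta>
           (\<lambda>x y. C * (exp_size d \<mu> \<delta> \<nu> a k x y *
              exp_gap d \<delta> (new_points \<A> z (int k)) \<nu> a k x y)) (K k))) \<and>
     (\<forall>x. (\<integral>y. K 0 x y \<partial>\<mu>) = 1 \<and> (\<integral>y. K 0 y x \<partial>\<mu>) = 1) \<and>
     (\<forall>k\<ge>1. \<forall>x. (\<integral>y. K k x y \<partial>\<mu>) = 0 \<and> (\<integral>y. K k y x \<partial>\<mu>) = 0)"

section \<open>Test functions and distributions\<close>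

definition test_decay ::
  "('a \<Rightarrow> 'a \<Rightarrow> real) \<Rightarrow> 'a measure \<Rightarrow> 'a \<Rightarrow> real \<Rightarrow> 'a \<Rightarrow> real" where
  "test_decay d \<mu> x0 \<gamma> x =
     1 / (vol d \<mu> 1 x0 + vol d \<mu> (d x0 x) x0) * (1 + d x0 x) powr (- \<gamma>)"

definition test_bound ::
  "('a \<Rightarrow> 'a \<Rightarrow> real) \<Rightarrow> real \<Rightarrow> 'a measure \<Rightarrow> 'a \<Rightarrow> real \<Rightarrow> real \<Rightarrow> ('a \<Rightarrow> complex) \<Rightarrow> real \<Rightarrow> bool" where
  "test_bound d A0 \<mu> x0 \<beta> \<gamma> f C \<longleftrightarrow>
     0 < C \<and> (\<forall>x. cmod (f x) \<le> C * test_decay d \<mu> x0 \<gamma> x) \<and>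
     (\<forall>x y. d x y \<le> (1 + d x0 x) / (2 * A0) \<longrightarrow>
        cmod (f x - f y) \<le> C * (d x y / (1 + d x0 x)) powr \<beta> * test_decay d \<mu> x0 \<gamma> x)"

definition test_space ::
  "('a \<Rightarrow> 'a \<Rightarrow> real) \<Rightarrow> real \<Rightarrow> 'a measure \<Rightarrow> 'a \<Rightarrow> real \<Rightarrow> real \<Rightarrow> ('a \<Rightarrow> complex) set" where
  "test_space d A0 \<mu> x0 \<beta> \<gamma> = {f. \<exists>C. test_bound d A0 \<mu> x0 \<beta> \<gamma> f C}"

definition test_norm ::
  "('a \<Rightarrow> 'a \<Rightarrow> real) \<Rightarrow> real \<Rightarrow> 'a measure \<Rightarrow> 'a \<Rightarrow> real \<Rightarrow> real \<Rightarrow> ('a \<Rightarrow> complex) \<Rightarrow> real" where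
  "test_norm d A0 \<mu> x0 \<beta> \<gamma> f = Inf {C. test_bound d A0 \<mu> x0 \<beta> \<gamma> f C}"

text \<open>$\mathcal G(\beta,\gamma)$ is complete, so the completion of $\mathcal G(\eta,\eta)$ in it is
  the closure.\<close>

definition test_space0 ::
  "('a \<Rightarrow> 'a \<Rightarrow> real) \<Rightarrow> real \<Rightarrow> 'a measure \<Rightarrow> 'a \<Rightarrow> real \<Rightarrow> real \<Rightarrow> real \<Rightarrow> ('a \<Rightarrow> complex) set" where
  "test_space0 d A0 \<mu> x0 \<eta> \<beta> \<gamma> =
     {f \<in> test_space d A0 \<mu> x0 \<beta> \<gamma>. \<exists>g. (\<forall>n::nat. g n \<in> test_space d A0 \<mu> x0 \<eta> \<eta>) \<and>
        (\<lambda>n. test_norm d A0 \<mu> x0 \<beta> \<gamma> (\<lambda>x. g n x - f x)) \<longlonglongrightarrow> 0}"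

text \<open>A distribution is a functional on all functions of which only the values on the test space
  matter; two distributions are equal if they agree there.\<close>

definition distributions ::
  "('a \<Rightarrow> 'a \<Rightarrow> real) \<Rightarrow> real \<Rightarrow> 'a measure \<Rightarrow> 'a \<Rightarrow> real \<Rightarrow> real \<Rightarrow> real \<Rightarrow>
   (('a \<Rightarrow> complex) \<Rightarrow> complex) set" where
  "distributions d A0 \<mu> x0 \<eta> \<beta> \<gamma> =
     (let G = test_space0 d A0 \<mu> x0 \<eta> \<beta> \<gamma> in
      {f. (\<forall>\<phi>\<in>G. \<forall>\<psi>\<in>G. f (\<lambda>x. \<phi> x + \<psi> x) = f \<phi> + f \<psi>) \<and>
          (\<forall>c. \<forall>\<phi>\<in>G. f (\<lambda>x. c * \<phi> x) = c * f \<phi>) \<and>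
          (\<exists>C. \<forall>\<phi>\<in>G. cmod (f \<phi>) \<le> C * test_norm d A0 \<mu> x0 \<beta> \<gamma> \<phi>)})"

definition fun_distr :: "'a measure \<Rightarrow> ('a \<Rightarrow> complex) \<Rightarrow> ('a \<Rightarrow> complex) \<Rightarrow> complex" where
  "fun_distr \<mu> g \<phi> = (\<integral>x. g x * \<phi> x \<partial>\<mu>)"

definition distr_op ::
  "('a \<Rightarrow> 'a \<Rightarrow> complex) \<Rightarrow> (('a \<Rightarrow> complex) \<Rightarrow> complex) \<Rightarrow> 'a \<Rightarrow> complex" where
  "distr_op K f x = f (\<lambda>y. K x y)"

section \<open>The reproducing formula\<close>

definition mean_on :: "'a measure \<Rightarrow> 'a set \<Rightarrow> ('a \<Rightarrow> complex) \<Rightarrow> complex" where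
  "mean_on \<mu> E g = (LINT x:E|\<mu>. g x) / of_real (measure \<mu> E)"

definition poly_size ::
  "('a \<Rightarrow> 'a \<Rightarrow> real) \<Rightarrow> 'a measure \<Rightarrow> real \<Rightarrow> real \<Rightarrow> 'a \<Rightarrow> 'a \<Rightarrow> real" where
  "poly_size d \<mu> \<gamma> r x y = 1 / (vol d \<mu> r x + vol d \<mu> (d x y) x) * (r / (r + d x y)) powr \<gamma>"

text \<open>The summand with index $k,\alpha,m$ of the reproducing formula, for the cube
  $E = Q^{k,m}_\alpha$ with sample point $p$; \<open>K\<close> and \<open>K'\<close> are $Q_k$ and $\widetilde Q_k$.\<close>

definition repr_term ::
  "'a measure \<Rightarrow> nat \<Rightarrow> nat \<Rightarrow> ('a \<Rightarrow> 'a \<Rightarrow> complex) \<Rightarrow> ('a \<Rightarrow> 'a \<Rightarrow> complex) \<Rightarrow> 'a set \<Rightarrow> 'a \<Rightarrow>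
   (('a \<Rightarrow> complex) \<Rightarrow> complex) \<Rightarrow> 'a \<Rightarrow> complex" where
  "repr_term \<mu> N k K K' E p f x =
     (if k = 0 then (LINT y:E|\<mu>. K' x y) * mean_on \<mu> E (distr_op K f)
      else if k \<le> N then of_real (measure \<mu> E) * K' x p * mean_on \<mu> E (distr_op K f)
      else of_real (measure \<mu> E) * K' x p * distr_op K f p)"

text \<open>Convergence in the space of distributions is weak-* convergence; for each $k$ the sum over the
  cubes is unconditional.\<close>

definition reproducing_formula ::
  "('a \<Rightarrow> 'a \<Rightarrow> real) \<Rightarrow> real \<Rightarrow> 'a measure \<Rightarrow> 'a \<Rightarrow> real \<Rightarrow> (int \<Rightarrow> 'i set) \<Rightarrow>
   (int \<Rightarrow> 'i \<Rightarrow> 'a set) \<Rightarrow> nat \<Rightarrow> real \<Rightarrow> (nat \<Rightarrow> 'a \<Rightarrow> 'a \<Rightarrow> complex) \<Rightarrow> nat \<Rightarrow> bool" where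
  "reproducing_formula d A0 \<mu> x0 \<delta> \<A> Q j0 \<eta> K N \<longleftrightarrow>
   (\<forall>\<beta>\<in>{0<..<\<eta>}. \<forall>\<gamma>\<in>{0<..<\<eta>}. \<exists>C>0.
    \<forall>p. (\<forall>k. \<forall>\<alpha>\<in>\<A> (int k). \<forall>\<tau>\<in>subcubes \<A> Q j0 k \<alpha>. p k \<alpha> \<tau> \<in> Q (int (k + j0)) \<tau>) \<longrightarrow>
    (\<exists>K'.
      (\<forall>k. bounded_L2_kernel \<mu> (K' k)) \<and>
      (\<forall>k x y. cmod (K' k x y) \<le> C * poly_size d \<mu> \<gamma> (\<delta> ^ k) x y) \<and>
      (\<forall>k x x' y. d x x' \<le> (\<delta> ^ k + d x y) / (2 * A0) \<longrightarrow>
         cmod (K' k x y - K' k x' y)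
           \<le> C * (d x x' / (\<delta> ^ k + d x y)) powr \<beta> * poly_size d \<mu> \<gamma> (\<delta> ^ k) x y) \<and>
      (\<forall>k x. (\<integral>y. K' k x y \<partial>\<mu>) = (if k \<le> N then 1 else 0) \<and>
             (\<integral>y. K' k y x \<partial>\<mu>) = (if k \<le> N then 1 else 0)) \<and>
      (\<forall>f\<in>distributions d A0 \<mu> x0 \<eta> \<beta> \<gamma>. \<forall>\<phi>\<in>test_space0 d A0 \<mu> x0 \<eta> \<beta> \<gamma>.
         let I = (\<lambda>k. SIGMA \<alpha>:\<A> (int k). subcubes \<A> Q j0 k \<alpha>);
             t = (\<lambda>k (\<alpha>, \<tau>). fun_distr \<mu>
                    (repr_term \<mu> N k (K k) (K' k) (Q (int (k + j0)) \<tau>) (p k \<alpha> \<tau>) f) \<phi>)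
         in (\<forall>k. t k summable_on I k) \<and> (\<lambda>k. infsum (t k) (I k)) sums f \<phi>)))"

section \<open>Besov and Hoelder spaces\<close>

definition Linf_norm :: "'a measure \<Rightarrow> ('a \<Rightarrow> complex) \<Rightarrow> ennreal" where
  "Linf_norm \<mu> f = esssup \<mu> (\<lambda>x. ennreal (cmod (f x)))"

definition besov_norm ::
  "'a measure \<Rightarrow> real \<Rightarrow> (int \<Rightarrow> 'i set) \<Rightarrow> (int \<Rightarrow> 'i \<Rightarrow> 'a set) \<Rightarrow> nat \<Rightarrow>
   (nat \<Rightarrow> 'a \<Rightarrow> 'a \<Rightarrow> complex) \<Rightarrow> nat \<Rightarrow> real \<Rightarrow> (('a \<Rightarrow> complex) \<Rightarrow> complex) \<Rightarrow> ennreal" where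
  "besov_norm \<mu> \<delta> \<A> Q j0 K N s f =
     (SUP k\<in>{0..N}. SUP \<alpha>\<in>\<A> (int k). SUP \<tau>\<in>subcubes \<A> Q j0 k \<alpha>.
        (\<integral>\<^sup>+x\<in>Q (int (k + j0)) \<tau>. ennreal (cmod (distr_op (K k) f x)) \<partial>\<mu>)
          / emeasure \<mu> (Q (int (k + j0)) \<tau>)) +
     (SUP k\<in>{N<..}. ennreal (\<delta> powr (- (real k * s))) * Linf_norm \<mu> (distr_op (K k) f))"

definition besov_space ::
  "('a \<Rightarrow> 'a \<Rightarrow> real) \<Rightarrow> real \<Rightarrow> 'a measure \<Rightarrow> 'a \<Rightarrow> real \<Rightarrow> (int \<Rightarrow> 'i set) \<Rightarrow>
   (int \<Rightarrow> 'i \<Rightarrow> 'a set) \<Rightarrow> nat \<Rightarrow> real \<Rightarrow> (nat \<Rightarrow> 'a \<Rightarrow> 'a \<Rightarrow> complex) \<Rightarrow> nat \<Rightarrow>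
   real \<Rightarrow> real \<Rightarrow> real \<Rightarrow> (('a \<Rightarrow> complex) \<Rightarrow> complex) set" where
  "besov_space d A0 \<mu> x0 \<delta> \<A> Q j0 \<eta> K N \<beta> \<gamma> s =
     {f \<in> distributions d A0 \<mu> x0 \<eta> \<beta> \<gamma>. besov_norm \<mu> \<delta> \<A> Q j0 K N s f < \<infinity>}"

definition hoelder_norm ::
  "('a \<Rightarrow> 'a \<Rightarrow> real) \<Rightarrow> 'a measure \<Rightarrow> real \<Rightarrow> ('a \<Rightarrow> complex) \<Rightarrow> ennreal" where
  "hoelder_norm d \<mu> s f =
     (SUP (x, y)\<in>{(x, y). x \<noteq> y}. ennreal (cmod (f x - f y) / d x y powr s)) + Linf_norm \<mu> f"

definition hoelder_space ::
  "('a \<Rightarrow> 'a \<Rightarrow> real) \<Rightarrow> 'a measure \<Rightarrow> real \<Rightarrow> ('a \<Rightarrow> complex) set" where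
  "hoelder_space d \<mu> s =
     {f. continuous_map (qtopology d) euclidean f \<and> hoelder_norm d \<mu> s f < \<infinity>}"

end

theory Submission
  imports Defs
begin

text \<open>For \<open>f\<close> in the Hoelder space and \<open>k \<ge> 1\<close> the cancellation of $Q_k$ gives
  $Q_kf(x) = \int Q_k(x,y)[f(y) - f(x)]\,d\mu(y)$, and
  $\int |Q_k(x,y)|\,d(x,y)^s\,d\mu(y) \lesssim \delta^{ks}$ by splitting into dyadic annuli, where
  the exponential decay beats the polynomial growth of the volume.

  Conversely, the reproducing formula writes \<open>f\<close> as a sum over \<open>k\<close> of functions
  $g_k$ with $|g_k| \lesssim \delta^{ks}$ and
  $|g_k(x) - g_k(x')| \lesssim \delta^{ks}[d(x,x')/\delta^k]^\beta$; since $0 < s < \beta$, these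
  two bounds sum to a function in the Hoelder space, which represents \<open>f\<close> by dominated
  convergence.\<close>

section \<open>Decay integrals on spaces of homogeneous type\<close>

text \<open>All estimates have to be uniform in the base point and the scale. They come from one
  device: on the ball of radius 2^j r the kernel is compared with 1/V(2^j r), whose integral over
  that ball is 1, so that only a factor geometric in j remains. Two obstacles shape the rest. First,
  the sigma-algebra of \<open>\<mu>\<close> is only known to contain balls and cubes, and balls need
  not be open; measurability of continuous functions and of test functions is derived by covering
  open sets with countably many balls about dyadic points. Second, the Besov norm b carries no decay
  on the scales k \<le> N. Since N is fixed, replacing b by b \<delta>^(-Ns) puts all scales under a
  single geometric bound. The kernels of the reproducing formula depend on the sample points and
  hence on f, so the Hoelder constant is built only from constants fixed before them. The exponent s
  emerges by splitting the series at the scale \<delta>^n close to d(x,x'): s > 0 sums the finer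
  scales, s < \<beta> the coarser ones.\<close>

text \<open>In \<open>homogeneous_type\<close> the doubling constant is bound by an existential
  quantifier; as the parameter \<open>D\<close> it can enter the constants below. No lower bound is
  assumed, \<open>D_ge_1\<close> derives one.\<close>

locale homogeneous_space =
  fixes d :: "'a \<Rightarrow> 'a \<Rightarrow> real" and A0 :: real and \<mu> :: "'a measure" and D :: real
  assumes homogeneous: "homogeneous_type d A0 \<mu>"
    and doubling_constant: "\<And>x r. 0 < r \<Longrightarrow> vol d \<mu> (2 * r) x \<le> D * vol d \<mu> r x"
begin

abbreviation V :: "real \<Rightarrow> 'a \<Rightarrow> real" where "V \<equiv> vol d \<mu>"

section \<open>Balls, volumes and doubling\<close>

lemma qm: "quasi_metric d A0" and space_eq: "space \<mu> = UNIV"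
  using homogeneous by (auto simp: homogeneous_type_def)

lemma A0_ge_1: "1 \<le> A0" and d_nonneg [simp]: "0 \<le> d x y" and d_eq_0_iff [simp]: "d x y = 0 \<longleftrightarrow> x = y"
  and d_sym: "d x y = d y x" and d_triangle: "d x z \<le> A0 * (d x y + d y z)"
  using qm by (auto simp: quasi_metric_def)

lemma d_pos: "x \<noteq> y \<Longrightarrow> 0 < d x y"
  using d_nonneg[of x y] d_eq_0_iff[of x y] by linarith

lemma qball_measurable [measurable]: "qball d x r \<in> sets \<mu>"
proof (cases "0 < r")
  case False
  then have "qball d x r = {}"
    using d_nonneg[of x] by (auto simp: qball_def not_less intro: order_trans)
  then show ?thesis by simp
qed (use homogeneous in \<open>auto simp: homogeneous_type_def\<close>)

lemma emeasure_qball_finite: "emeasure \<mu> (qball d x r) < \<infinity>"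
proof (cases "0 < r")
  case False
  then have "qball d x r = {}"
    using d_nonneg[of x] by (auto simp: qball_def not_less intro: order_trans)
  then show ?thesis by simp
qed (use homogeneous in \<open>auto simp: homogeneous_type_def\<close>)

lemma emeasure_qball: "emeasure \<mu> (qball d x r) = ennreal (V r x)"
  using emeasure_qball_finite[of x r] by (auto simp: vol_def emeasure_eq_ennreal_measure)

lemma V_pos: "0 < r \<Longrightarrow> 0 < V r x"
  using homogeneous emeasure_qball[of x r] unfolding homogeneous_type_def by (metis ennreal_less_zero_iff)

lemma V_nonneg [simp]: "0 \<le> V r x"
  by (simp add: vol_def)

lemma V_mono_set: "qball d x r \<subseteq> qball d y t \<Longrightarrow> V r x \<le> V t y"
  using emeasure_mono[of "qball d x r" "qball d y t" \<mu>] by (simp add: emeasure_qball)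

lemma V_mono: "r \<le> t \<Longrightarrow> V r x \<le> V t x"
  by (rule V_mono_set) (auto simp: qball_def)

text \<open>By the quasi-triangle inequality the ball on the left is contained in the one on the
  right. This compares volumes at different centres, as needed for the root of V(x)V(y) in
  \<open>exp_size\<close>.\<close>

lemma V_shift: "V r x \<le> V (A0 * (r + d x y)) y"
proof (rule V_mono_set, clarsimp simp: qball_def)
  fix w assume "d x w < r"
  then have "A0 * (d y x + d x w) < A0 * (r + d x y)"
    using A0_ge_1 by (simp add: d_sym[of x y])
  then show "d y w < A0 * (r + d x y)"
    using d_triangle[of y w x] by linarith
qed

lemma D_ge_1: "1 \<le> D"
proof -
  have "V 1 undefined \<le> D * V 1 undefined"
    using V_mono[of 1 2 undefined] doubling_constant[of 1 undefined] by simp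
  then show ?thesis using V_pos[of 1 undefined] by simp
qed

lemma doubling_pow: "0 < r \<Longrightarrow> V (2 ^ j * r) x \<le> D ^ j * V r x"
proof (induction j)
  case (Suc j)
  have "V (2 ^ Suc j * r) x \<le> D * V (2 ^ j * r) x"
    using doubling_constant[of "2 ^ j * r" x] Suc.prems by (simp add: mult.assoc)
  also have "\<dots> \<le> D * (D ^ j * V r x)"
    using Suc D_ge_1 by (intro mult_left_mono) auto
  finally show ?case by (simp add: mult.assoc)
qed simp

lemma doubling_ex:
  obtains C where "1 \<le> C" "\<And>x r. 0 < r \<Longrightarrow> V (b * r) x \<le> C * V r x"
proof -
  obtain j where j: "b < 2 ^ j"
    using real_arch_pow[of 2 b] by auto
  show ?thesis
  proof
    show "1 \<le> D ^ j" using D_ge_1 by simp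
    show "V (b * r) x \<le> D ^ j * V r x" if "0 < r" for x r
      using V_mono[of "b * r" "2 ^ j * r" x] doubling_pow[OF that, of j x] j that by simp
  qed
qed

lemma sigma_finite: "sigma_finite_measure \<mu>"
proof
  show "\<exists>A. countable A \<and> A \<subseteq> sets \<mu> \<and> \<Union> A = space \<mu> \<and> (\<forall>a\<in>A. emeasure \<mu> a \<noteq> \<infinity>)"
  proof (intro exI conjI)
    show "\<Union> (range (\<lambda>n::nat. qball d undefined (real n))) = space \<mu>"
      using reals_Archimedean2 by (fastforce simp: space_eq qball_def)
    show "\<forall>a\<in>range (\<lambda>n::nat. qball d undefined (real n)). emeasure \<mu> a \<noteq> \<infinity>"
      using emeasure_qball_finite by (auto simp: less_top)
  qed auto
qed

section \<open>Integrals over dyadic annuli and their discretisations\<close>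

text \<open>Assign to y the least j with d x y < 2 ^ j * r; then j = 0 or y lies at least half the
  radius away from x, which is the case distinction in the hypothesis on \<open>g\<close>. After
  division by its volume the j-th ball contributes c * q ^ j, and a geometric series is
  left.\<close>

lemma nn_integral_annuli:
  assumes "0 < r" "0 \<le> c" "0 \<le> q" "q < 1"
    and g: "\<And>y j. d x y < 2 ^ j * r \<Longrightarrow> j = 0 \<or> 2 ^ j * r \<le> 2 * d x y \<Longrightarrow>
              g y \<le> ennreal (c * q ^ j / V (2 ^ j * r) x)"
  shows "(\<integral>\<^sup>+y. g y \<partial>\<mu>) \<le> ennreal (c / (1 - q))"
proof -
  let ?h = "\<lambda>j y. ennreal (c * q ^ j / V (2 ^ j * r) x) * indicator (qball d x (2 ^ j * r)) y"
  have "g y \<le> (\<Sum>j. ?h j y)" for y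
  proof -
    have "\<exists>j. d x y < 2 ^ j * r"
      using real_arch_pow[of 2 "d x y / r"] assms(1) by (auto simp: field_simps)
    then obtain j where j: "d x y < 2 ^ j * r" "\<And>i. i < j \<Longrightarrow> \<not> d x y < 2 ^ i * r"
      using exists_least_iff[of "\<lambda>j. d x y < 2 ^ j * r"] by auto
    have "j = 0 \<or> 2 ^ j * r \<le> 2 * d x y"
      using j(2)[of "j - 1"] by (cases j) auto
    then have "g y \<le> ?h j y"
      using g[OF j(1)] j(1) by (simp add: qball_def)
    also have "\<dots> \<le> (\<Sum>j. ?h j y)"
      using sum_le_suminf[of "\<lambda>j. ?h j y" "{j}"] by (simp del: sum_mult_indicator)
    finally show ?thesis .
  qed
  then have "(\<integral>\<^sup>+y. g y \<partial>\<mu>) \<le> (\<integral>\<^sup>+y. (\<Sum>j. ?h j y) \<partial>\<mu>)"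
    by (intro nn_integral_mono) auto
  also have "\<dots> = (\<Sum>j. \<integral>\<^sup>+y. ?h j y \<partial>\<mu>)"
    by (intro nn_integral_suminf) measurable
  also have "\<dots> = (\<Sum>j. ennreal (c * q ^ j))"
  proof (rule suminf_cong)
    fix j
    have "V (2 ^ j * r) x > 0" using assms(1) by (simp add: V_pos)
    then show "(\<integral>\<^sup>+y. ?h j y \<partial>\<mu>) = ennreal (c * q ^ j)"
      using assms by (subst nn_integral_cmult_indicator)
        (auto simp: emeasure_qball ennreal_mult'[symmetric])
  qed
  also have "\<dots> = ennreal (c / (1 - q))"
  proof (rule sums_unique[symmetric])
    have "(\<lambda>j. c * q ^ j) sums (c * (1 / (1 - q)))"
      using assms by (intro sums_mult geometric_sums) auto
    then show "(\<lambda>j. ennreal (c * q ^ j)) sums ennreal (c / (1 - q))"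
      using assms by (subst sums_ennreal) auto
  qed
  finally show ?thesis .
qed

lemma poly_size_nonneg [simp]: "0 \<le> poly_size d \<mu> g r x y"
  by (simp add: poly_size_def)

lemma poly_size_pos: "0 < r \<Longrightarrow> 0 < poly_size d \<mu> g r x y"
  using V_pos[of r x] d_nonneg[of x y] add_pos_nonneg[of r "d x y"] add_pos_nonneg[of "V r x" "V (d x y) x"]
  by (simp add: poly_size_def)

text \<open>On the j-th annulus doubling bounds the volume factor by D / V (2 ^ j * r) x, and the
  decay factor is at most 2 powr g times the j-th power of q = 2 powr (- g). The free factor M
  spares later rescaling inside \<open>ennreal\<close>.\<close>

lemma nn_integral_poly_size:
  assumes "0 < g"
  obtains C where "0 < C" "\<And>r x M. 0 < r \<Longrightarrow> 0 \<le> M \<Longrightarrow>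
    (\<integral>\<^sup>+y. ennreal (M * poly_size d \<mu> g r x y) \<partial>\<mu>) \<le> ennreal (M * C)"
proof
  define q where "q = 2 powr (- g)"
  have q: "0 < q" "q < 1" using assms by (auto simp: q_def powr_less_one)
  show "0 < D * 2 powr g / (1 - q)" using q D_ge_1 by simp
  fix r x M assume r: "0 < (r::real)" and M: "0 \<le> (M::real)"
  have "(\<integral>\<^sup>+y. ennreal (M * poly_size d \<mu> g r x y) \<partial>\<mu>) \<le> ennreal (M * (D * 2 powr g) / (1 - q))"
  proof (rule nn_integral_annuli[OF r])
    fix y j assume j: "d x y < 2 ^ j * r" "j = 0 \<or> 2 ^ j * r \<le> 2 * d x y"
    have V: "V (2 ^ j * r) x \<le> D * (V r x + V (d x y) x)"
    proof (cases "j = 0")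
      case True
      have "1 * V r x \<le> D * (V r x + V (d x y) x)"
        using D_ge_1 by (intro mult_mono) auto
      then show ?thesis using True by simp
    next
      case False
      then have "0 < d x y" using j r by (auto intro: order_less_le_trans[of _ "2 ^ j * r / 2"])
      have "V (2 ^ j * r) x \<le> V (2 * d x y) x" using j False by (intro V_mono) auto
      also have "\<dots> \<le> D * V (d x y) x" by (rule doubling_constant) fact
      also have "\<dots> \<le> D * (V r x + V (d x y) x)" using D_ge_1 by (intro mult_left_mono) auto
      finally show ?thesis .
    qed
    have "2 ^ j * r \<le> 2 * (r + d x y)"
      using j r by (cases "j = 0") auto
    then have "r / (r + d x y) \<le> 2 / 2 ^ j"
      using r by (simp add: field_simps add_pos_nonneg)
    then have "(r / (r + d x y)) powr g \<le> (2 / 2 ^ j) powr g"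
      using assms r by (intro powr_mono2) auto
    also have "\<dots> = 2 powr g * q ^ j"
      by (simp add: q_def powr_divide powr_minus field_simps flip: powr_realpow powr_powr)
        (simp add: powr_powr mult.commute)
    finally have P: "(r / (r + d x y)) powr g \<le> 2 powr g * q ^ j" .
    have "1 / (V r x + V (d x y) x) \<le> D / V (2 ^ j * r) x"
      using V V_pos[OF r, of x] V_pos[of "2 ^ j * r" x] r
      by (simp add: field_simps add_pos_nonneg)
    then have "poly_size d \<mu> g r x y \<le> D / V (2 ^ j * r) x * (2 powr g * q ^ j)"
      unfolding poly_size_def using P D_ge_1 by (intro mult_mono) auto
    then have "M * poly_size d \<mu> g r x y \<le> M * (D / V (2 ^ j * r) x * (2 powr g * q ^ j))"
      using M by (rule mult_left_mono)
    then show "ennreal (M * poly_size d \<mu> g r x y) \<le> ennreal (M * (D * 2 powr g) * q ^ j / V (2 ^ j * r) x)"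
      by (intro ennreal_leI) simp
  qed (use q D_ge_1 M in auto)
  then show "(\<integral>\<^sup>+y. ennreal (M * poly_size d \<mu> g r x y) \<partial>\<mu>) \<le> ennreal (M * (D * 2 powr g / (1 - q)))"
    by simp
qed

text \<open>Moving the second argument by at most c * r enlarges r + d x p at most by the factor b =
  A0 * (1 + c); doubling turns this into a bounded factor for the volumes.\<close>

lemma poly_size_comparable:
  assumes "0 < g" "0 \<le> c"
  obtains C where "0 < C" "\<And>r x p y. 0 < r \<Longrightarrow> d p y \<le> c * r \<Longrightarrow>
     poly_size d \<mu> g r x p \<le> C * poly_size d \<mu> g r x y"
proof -
  define b where "b = A0 * (1 + c)"
  have b: "1 \<le> b" using A0_ge_1 assms mult_mono[of 1 A0 1 "1 + c"] by (simp add: b_def)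
  obtain C where C: "1 \<le> C" "\<And>x r. 0 < r \<Longrightarrow> V (2 * b * r) x \<le> C * V r x"
    using doubling_ex[of "2 * b"] by blast
  show ?thesis
  proof
    show "0 < 2 * C * b powr g" using C b by simp
    fix r x p y assume r: "0 < (r::real)" and y: "d p y \<le> c * r"
    have bd: "r + d x y \<le> b * (r + d x p)" 
    proof -
      have "A0 * (d x p + d p y) \<le> A0 * (d x p + c * r)"
        using y A0_ge_1 by simp
      then have "d x y \<le> A0 * (d x p + c * r)"
        using d_triangle[of x y p] by linarith
      moreover have "r \<le> A0 * r" using A0_ge_1 r by simp
      moreover have "0 \<le> A0 * (c * d x p)" using A0_ge_1 assms by simp
      ultimately show ?thesis by (simp add: b_def algebra_simps)
    qed
    have V: "V r x + V (d x y) x \<le> 2 * C * (V r x + V (d x p) x)"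
    proof -
      \<comment> \<open>V m x is one of the two volumes on the right, while both volumes on the left
        are at most V (2 * b * m) x. Hence the dilation 2 * b in the choice of C.\<close>
      define m where "m = max r (d x p)"
      have m: "0 < m" "r + d x p \<le> 2 * m" using r by (auto simp: m_def)
      have "r + d x y \<le> 2 * b * m"
        using order_trans[OF bd mult_left_mono[OF m(2), of b]] b by (simp add: mult_ac)
      then have "V r x \<le> V (2 * b * m) x" "V (d x y) x \<le> V (2 * b * m) x"
        using r d_nonneg[of x y] by (auto intro!: V_mono simp del: d_nonneg)
      then have "V r x + V (d x y) x \<le> 2 * (C * V m x)"
        using C(2)[OF m(1), of x] by linarith
      also have "C * V m x \<le> C * (V r x + V (d x p) x)"
        using C(1) by (intro mult_left_mono) (auto simp: m_def max_def)
      finally show ?thesis by simp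
    qed
    have Vpos: "0 < V r x + V (d x y) x" "0 < V r x + V (d x p) x"
      using V_pos[OF r, of x] by (auto intro: add_pos_nonneg)
    have 1: "1 / (V r x + V (d x p) x) \<le> 2 * C * (1 / (V r x + V (d x y) x))"
      using V Vpos by (simp add: field_simps)
    have "r / (r + d x p) \<le> b * (r / (r + d x y))"
    proof -
      have "r * (r + d x y) \<le> r * (b * (r + d x p))"
        using bd r by (intro mult_left_mono) auto
      then show ?thesis using r by (simp add: divide_simps add_pos_nonneg mult_ac)
    qed
    then have "(r / (r + d x p)) powr g \<le> (b * (r / (r + d x y))) powr g"
      using r assms by (intro powr_mono2) auto
    then have 2: "(r / (r + d x p)) powr g \<le> b powr g * (r / (r + d x y)) powr g"
      using b r powr_mult[of b "r / (r + d x y)" g] by (simp del: times_divide_eq_right)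
    have "poly_size d \<mu> g r x p \<le>
        (2 * C * (1 / (V r x + V (d x y) x))) * (b powr g * (r / (r + d x y)) powr g)"
      unfolding poly_size_def by (rule mult_mono[OF 1 2]) (use C Vpos in auto)
    then show "poly_size d \<mu> g r x p \<le> 2 * C * b powr g * poly_size d \<mu> g r x y"
      by (simp add: poly_size_def algebra_simps)
  qed
qed

text \<open>A Riemann sum: the value at p i is at most C2 times the value at each y in E i, so the
  sum is dominated by an integral over disjoint sets. The bound does not depend on the finite set F
  and thus controls infinite families as well.\<close>

lemma sum_measure_poly_size:
  assumes "0 < g" "0 \<le> c"
  obtains C where "0 < C" "\<And>r x F E p. 0 < r \<Longrightarrow> finite F \<Longrightarrow> disjoint_family_on E F \<Longrightarrow>
     (\<forall>i\<in>F. E i \<in> sets \<mu>) \<Longrightarrow> (\<forall>i\<in>F. \<forall>y\<in>E i. d (p i) y \<le> c * r) \<Longrightarrow>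
     (\<Sum>i\<in>F. measure \<mu> (E i) * poly_size d \<mu> g r x (p i)) \<le> C"
proof -
  obtain C1 where C1: "0 < C1" "\<And>r x M. 0 < r \<Longrightarrow> 0 \<le> M \<Longrightarrow>
      (\<integral>\<^sup>+y. ennreal (M * poly_size d \<mu> g r x y) \<partial>\<mu>) \<le> ennreal (M * C1)"
    using nn_integral_poly_size[OF assms(1)] by blast
  obtain C2 where C2: "0 < C2" "\<And>r x p y. 0 < r \<Longrightarrow> d p y \<le> c * r \<Longrightarrow>
     poly_size d \<mu> g r x p \<le> C2 * poly_size d \<mu> g r x y"
    using poly_size_comparable[OF assms] by blast
  show ?thesis
  proof
    show "0 < C2 * C1" using C1 C2 by simp
    fix r x F p and E :: "'b \<Rightarrow> 'a set"
    assume r: "0 < (r::real)" and fin: "finite F" and disj: "disjoint_family_on E F"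
      and E: "\<forall>i\<in>F. E i \<in> sets \<mu>"
      and p: "\<forall>i\<in>F. \<forall>y\<in>E i. d (p i) y \<le> c * r"
    \<comment> \<open>\<open>measure\<close> returns 0 on a set of infinite measure, so finiteness
      is first read off from a ball that contains E i.\<close>
    have meas: "emeasure \<mu> (E i) = ennreal (measure \<mu> (E i))" if "i \<in> F" for i
    proof (intro emeasure_eq_ennreal_measure)
      have "E i \<subseteq> qball d (p i) (c * r + 1)"
        using p that by (force simp: qball_def)
      then show "emeasure \<mu> (E i) \<noteq> top"
        using emeasure_mono[of "E i" _ \<mu>, OF _ qball_measurable] emeasure_qball_finite
        by (metis infinity_ennreal_def less_top order_le_less_trans)
    qed
    have "ennreal (\<Sum>i\<in>F. measure \<mu> (E i) * poly_size d \<mu> g r x (p i)) =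
        (\<Sum>i\<in>F. ennreal (poly_size d \<mu> g r x (p i)) * emeasure \<mu> (E i))"
      by (subst sum_ennreal[symmetric])
         (auto intro!: sum.cong simp: meas ennreal_mult' mult.commute)
    also have "\<dots> = (\<integral>\<^sup>+y. (\<Sum>i\<in>F. ennreal (poly_size d \<mu> g r x (p i)) * indicator (E i) y) \<partial>\<mu>)"
      using E by (subst nn_integral_sum) (auto intro!: sum.cong simp: nn_integral_cmult_indicator)
    also have "\<dots> \<le> (\<integral>\<^sup>+y. ennreal C2 * ennreal (poly_size d \<mu> g r x y) \<partial>\<mu>)"
    proof (intro nn_integral_mono)
      fix y
      show "(\<Sum>i\<in>F. ennreal (poly_size d \<mu> g r x (p i)) * indicator (E i) y)
         \<le> ennreal C2 * ennreal (poly_size d \<mu> g r x y)"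
      proof (cases "\<exists>i\<in>F. y \<in> E i")
        case True
        then obtain i where i: "i \<in> F" "y \<in> E i" by blast
        then have "y \<notin> E j" if "j \<in> F" "j \<noteq> i" for j
          using disj that by (auto simp: disjoint_family_on_def)
        then have "(\<Sum>i\<in>F. ennreal (poly_size d \<mu> g r x (p i)) * indicator (E i) y) =
            (\<Sum>j\<in>{i}. ennreal (poly_size d \<mu> g r x (p j)) * indicator (E j) y)"
          using i fin by (intro sum.mono_neutral_right) auto
        also have "\<dots> = ennreal (poly_size d \<mu> g r x (p i))"
          using i by simp
        also have "\<dots> \<le> ennreal C2 * ennreal (poly_size d \<mu> g r x y)"
          using C2(2)[OF r, of "p i" y x] p i C2(1) by (simp add: ennreal_mult'[symmetric] ennreal_leI)
        finally show ?thesis .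
      qed (auto intro!: sum_nonpos)
    qed
    finally have le: "ennreal (\<Sum>i\<in>F. measure \<mu> (E i) * poly_size d \<mu> g r x (p i))
       \<le> (\<integral>\<^sup>+y. ennreal (C2 * poly_size d \<mu> g r x y) \<partial>\<mu>)"
      using C2(1) by (simp add: ennreal_mult'[symmetric])
    show "(\<Sum>i\<in>F. measure \<mu> (E i) * poly_size d \<mu> g r x (p i)) \<le> C2 * C1"
      using order_trans[OF le C1(2)[OF r, of C2 x]] C1(1) C2(1) by simp
  qed
qed

end

section \<open>Exponentially decaying kernels\<close>

text \<open>Put u = 2 powr (a * j). As exp t \<ge> t, exp (\<nu> * u) dominates (\<nu> * u / M) ^ M
  for every M > 0. Choosing M with (2 powr a) ^ M > 2 * P makes u ^ M at least (2 * P) ^ j, and the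
  spare factor 2 yields the decay.\<close>

lemma geometric_exp_decay:
  fixes P \<nu> a :: real
  assumes "0 < P" "0 < \<nu>" "0 < a"
  obtains c where "0 < c" "\<And>j::nat. P ^ j * exp (- \<nu> * 2 powr (a * j)) \<le> c * (1 / 2) ^ j"
proof -
  have "1 < 2 powr a" using assms by simp
  then obtain M0 where "2 * P < (2 powr a) ^ M0"
    using real_arch_pow by blast
  \<comment> \<open>The successor makes the exponent positive, as the later division by M
    requires.\<close>
  also have "\<dots> \<le> (2 powr a) ^ Suc M0"
    using \<open>1 < 2 powr a\<close> by (intro power_increasing) auto
  finally obtain M :: nat where M: "0 < M" "2 * P < (2 powr a) ^ M" by blast
  show ?thesis
  proof
    show "0 < (M / \<nu>) ^ M" using assms M by simp
    fix j :: nat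
    define u where "u = 2 powr (a * j)"
    have u: "0 < u" by (simp add: u_def)
    have "(\<nu> * u / M) ^ M \<le> exp (\<nu> * u / M) ^ M"
      using assms u exp_ge_add_one_self[of "\<nu> * u / M"] by (intro power_mono) (linarith, simp)
    also have "\<dots> = exp (\<nu> * u)"
      using M by (simp flip: exp_of_nat_mult)
    finally have "u ^ M \<le> (M / \<nu>) ^ M * exp (\<nu> * u)"
      using assms M by (simp add: power_divide power_mult_distrib field_simps)
    moreover have "u ^ M = ((2 powr a) ^ M) ^ j"
      by (simp add: u_def powr_powr[symmetric] powr_realpow mult.commute flip: power_mult)
    moreover have "(2 * P) ^ j \<le> ((2 powr a) ^ M) ^ j"
      using M assms by (intro power_mono) auto
    ultimately have "(2 * P) ^ j \<le> (M / \<nu>) ^ M * exp (\<nu> * u)" by linarith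
    then show "P ^ j * exp (- \<nu> * 2 powr (a * j)) \<le> (M / \<nu>) ^ M * (1 / 2) ^ j"
      using assms by (simp add: u_def[symmetric] exp_minus power_mult_distrib power_divide field_simps)
  qed
qed

lemma topspace_qtopology [simp]: "topspace (qtopology d) = UNIV"
proof -
  have "openin (qtopology d) UNIV"
    by (auto simp: openin_qtopology intro: exI[of _ 1])
  then show ?thesis using openin_subset by blast
qed

context homogeneous_space
begin

text \<open>The weight 1 + u powr s, with u = d x y / \<delta> ^ k, covers total mass and s-th
  moment at once. On the j-th annulus the volumes cost a multiple of \<open>(D\<^sup>2) ^ j\<close>,
  and the weight is at most 2 * 2 ^ j because s \<le> 1; the exponential absorbs both and still
  leaves (1 / 2) ^ j.\<close>

lemma nn_integral_exp_size:
  assumes "0 < \<delta>" "0 < \<nu>" "0 < a" "0 \<le> s" "s \<le> 1"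
  obtains C where "0 < C" "\<And>k x M. 0 \<le> M \<Longrightarrow>
    (\<integral>\<^sup>+y. ennreal (M * (exp_size d \<mu> \<delta> \<nu> a k x y * (1 + (d x y / \<delta> ^ k) powr s))) \<partial>\<mu>)
      \<le> ennreal (M * C)"
proof -
  \<comment> \<open>For j > 0 only u \<ge> 2 ^ j / 2 is known; the division by 2 powr a accounts for
    that half.\<close>
  define \<nu>' where "\<nu>' = \<nu> / 2 powr a"
  have \<nu>': "0 < \<nu>'" using assms by (simp add: \<nu>'_def)
  obtain c where c: "0 < c"
    "\<And>j::nat. (2 * D\<^sup>2) ^ j * exp (- \<nu>' * 2 powr (a * j)) \<le> c * (1 / 2) ^ j"
    using geometric_exp_decay[of "2 * D\<^sup>2" \<nu>' a] assms \<nu>' D_ge_1 by auto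
  obtain C1 where C1: "1 \<le> C1" "\<And>x r. 0 < r \<Longrightarrow> V (2 * A0 * r) x \<le> C1 * V r x"
    using doubling_ex[of "2 * A0"] by blast
  define C where "C = 2 * C1 * exp \<nu>' * c"
  have C: "0 < C" using C1 c by (simp add: C_def)
  show ?thesis
  proof
    show "0 < 2 * C" using C by simp
    fix k x M assume M: "0 \<le> (M::real)"
    define r where "r = \<delta> ^ k"
    have r: "0 < r" using assms by (simp add: r_def)
    have "(\<integral>\<^sup>+y. ennreal (M * (exp_size d \<mu> \<delta> \<nu> a k x y * (1 + (d x y / \<delta> ^ k) powr s))) \<partial>\<mu>)
      \<le> ennreal (M * C / (1 - 1 / 2))"
    proof (rule nn_integral_annuli[OF r])
      fix y j assume j: "d x y < 2 ^ j * r" "j = 0 \<or> 2 ^ j * r \<le> 2 * d x y"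
      define W where "W = V (2 ^ j * r) x"
      have W: "0 < W" using r by (simp add: W_def V_pos)
      have Vr: "0 < V r x" "0 < V r y" using r by (simp_all add: V_pos)
      have Wx: "W \<le> D ^ j * V r x" unfolding W_def by (rule doubling_pow[OF r])
      have xy: "V r x \<le> C1 * D ^ j * V r y"
      proof -
        have "1 * r \<le> 2 ^ j * r" using r by (intro mult_right_mono) auto
        then have "r + d x y \<le> 2 * (2 ^ j * r)" using j by simp
        then have "A0 * (r + d x y) \<le> A0 * (2 * (2 ^ j * r))"
          using A0_ge_1 by (intro mult_left_mono) auto
        then have "V r x \<le> V (2 * A0 * (2 ^ j * r)) y"
          by (intro order_trans[OF V_shift V_mono]) (simp add: mult_ac)
        also have "\<dots> \<le> C1 * V (2 ^ j * r) y" using r by (intro C1) auto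
        also have "\<dots> \<le> C1 * (D ^ j * V r y)"
          using C1 doubling_pow[OF r] by (intro mult_left_mono) auto
        finally show ?thesis by (simp add: mult.assoc)
      qed
      \<comment> \<open>One factor D ^ j compares the j-th ball with V r x, a second one compares V
        r x with V r y. With the same B against both volumes, multiplying the two bounds and taking
        the root gives the estimate for the geometric mean.\<close>
      define B where "B = C1 * (D\<^sup>2) ^ j"
      have D2: "(D\<^sup>2) ^ j = D ^ j * D ^ j"
        by (simp add: power2_eq_square power_mult_distrib)
      have Dj: "1 \<le> D ^ j" using D_ge_1 by simp
      have B: "0 < B" using C1 D_ge_1 by (simp add: B_def)
      have "W \<le> D ^ j * (C1 * D ^ j * V r y)"
        using Wx xy Dj by (intro order_trans[OF Wx] mult_left_mono) auto
      then have WBy: "W \<le> B * V r y" by (simp add: B_def D2 mult_ac)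
      have "1 * (1 * D ^ j) * V r x \<le> C1 * (D ^ j * D ^ j) * V r x"
        using C1 Dj by (intro mult_right_mono mult_mono) auto
      then have WBx: "W \<le> B * V r x" using Wx by (simp add: B_def D2)
      have "W * W \<le> (B * V r x) * (B * V r y)"
        using WBx WBy W by (intro mult_mono) auto
      then have "W\<^sup>2 \<le> B\<^sup>2 * (V r x * V r y)"
        by (simp add: power2_eq_square mult_ac)
      then have "sqrt (W\<^sup>2) \<le> sqrt (B\<^sup>2 * (V r x * V r y))"
        by (rule real_sqrt_le_mono)
      then have "W \<le> B * sqrt (V r x * V r y)"
        using W B by (simp add: real_sqrt_mult)
      then have 1: "1 / sqrt (V r x * V r y) \<le> B / W"
        using W B Vr by (simp add: field_simps)
      define u where "u = d x y / r"
      have u: "0 \<le> u" "u < 2 ^ j" "j = 0 \<or> 2 ^ j / 2 \<le> u"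
        using j r by (auto simp: u_def field_simps)
      have 2: "1 + u powr s \<le> 2 * 2 ^ j"
      proof -
        have "u powr s \<le> (2 ^ j) powr s" using u assms by (intro powr_mono2) auto
        also have "\<dots> \<le> (2 ^ j) powr 1" using assms by (intro powr_mono) auto
        finally have "u powr s \<le> 2 ^ j" by simp
        moreover have "(1::real) \<le> 2 ^ j" by simp
        ultimately show ?thesis by linarith
      qed
      \<comment> \<open>The factor exp \<nu>' serves the case j = 0, where the right-hand side
        becomes 1.\<close>
      have 3: "exp (- \<nu> * u powr a) \<le> exp \<nu>' * exp (- \<nu>' * 2 powr (a * j))"
      proof (cases "j = 0")
        case True
        have "0 \<le> \<nu> * u powr a" using assms by simp
        then show ?thesis using True by (simp flip: exp_add)
      next
        case False
        then have "(2 ^ j / 2) powr a \<le> u powr a" using u assms by (intro powr_mono2) auto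
        moreover have "(2 ^ j / 2) powr a = 2 powr (a * j) / 2 powr a"
          by (simp add: powr_divide powr_powr mult.commute flip: powr_realpow)
        ultimately have "2 powr (a * j) / 2 powr a \<le> u powr a" by simp
        then have "\<nu> * (2 powr (a * j) / 2 powr a) \<le> \<nu> * u powr a"
          using assms by (intro mult_left_mono) auto
        then have "\<nu>' * 2 powr (a * j) \<le> \<nu> * u powr a" by (simp add: \<nu>'_def)
        then show ?thesis using \<nu>' by (simp flip: exp_add)
      qed
      have "exp_size d \<mu> \<delta> \<nu> a k x y * (1 + u powr s)
         \<le> (B / W * (exp \<nu>' * exp (- \<nu>' * 2 powr (a * j)))) * (2 * 2 ^ j)"
        unfolding exp_size_def r_def[symmetric] u_def[symmetric]
        using 1 2 3 B W by (intro mult_mono) auto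
      also have "\<dots> = 2 * C1 * exp \<nu>' / W * ((2 * D\<^sup>2) ^ j * exp (- \<nu>' * 2 powr (a * j)))"
        by (simp add: B_def power_mult_distrib)
      also have "\<dots> \<le> 2 * C1 * exp \<nu>' / W * (c * (1 / 2) ^ j)"
        using C1 W by (intro mult_left_mono c) auto
      finally have "exp_size d \<mu> \<delta> \<nu> a k x y * (1 + u powr s) \<le> C * (1 / 2) ^ j / W"
        by (simp add: C_def)
      from mult_left_mono[OF this M]
      show "ennreal (M * (exp_size d \<mu> \<delta> \<nu> a k x y * (1 + (d x y / \<delta> ^ k) powr s)))
        \<le> ennreal (M * C * (1 / 2) ^ j / V (2 ^ j * r) x)"
        by (intro ennreal_leI) (simp add: u_def r_def[symmetric] W_def mult.assoc)
    qed (use M C in auto)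
    then show "(\<integral>\<^sup>+y. ennreal (M * (exp_size d \<mu> \<delta> \<nu> a k x y * (1 + (d x y / \<delta> ^ k) powr s))) \<partial>\<mu>)
      \<le> ennreal (M * (2 * C))"
      by (simp add: mult_ac)
  qed
qed

section \<open>Countability, continuity and test functions\<close>

text \<open>Weighted with the everywhere positive \<open>poly_size\<close>, the measures of the sets
  have bounded finite sums even if \<open>\<mu>\<close> is infinite, and a summable family of
  positive numbers has a countable index set. The exponent 1 and the point \<open>undefined\<close>
  are arbitrary choices.\<close>

lemma countable_family:
  assumes "0 < r" "0 \<le> c" "disjoint_family_on E I"
    and "\<And>i. i \<in> I \<Longrightarrow> E i \<in> sets \<mu>" "\<And>i. i \<in> I \<Longrightarrow> measure \<mu> (E i) > 0"
    and "\<And>i y. i \<in> I \<Longrightarrow> y \<in> E i \<Longrightarrow> d (p i) y \<le> c * r"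
  shows "countable I"
proof -
  define h where "h = (\<lambda>i. measure \<mu> (E i) * poly_size d \<mu> 1 r undefined (p i))"
  have h: "0 < h i" if "i \<in> I" for i
    unfolding h_def using assms(5)[OF that] poly_size_pos[OF assms(1)] by simp
  have "h summable_on I"
  proof (rule sum_measure_poly_size[OF zero_less_one assms(2), where ?'b = 'b])
    fix C assume C: "\<And>r x F (E :: 'b \<Rightarrow> 'a set) p. 0 < r \<Longrightarrow> finite F \<Longrightarrow> disjoint_family_on E F \<Longrightarrow>
      \<forall>i\<in>F. E i \<in> sets \<mu> \<Longrightarrow> \<forall>i\<in>F. \<forall>y\<in>E i. d (p i) y \<le> c * r \<Longrightarrow>
      (\<Sum>i\<in>F. measure \<mu> (E i) * poly_size d \<mu> 1 r x (p i)) \<le> C"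
    show ?thesis
    proof (rule nonneg_bdd_above_summable_on)
      show "bdd_above (sum h ` {F. F \<subseteq> I \<and> finite F})"
      proof (rule bdd_aboveI2)
        fix F assume F: "F \<in> {F. F \<subseteq> I \<and> finite F}"
        then have "disjoint_family_on E F"
          using assms(3) by (auto intro: disjoint_family_on_mono)
        then show "sum h F \<le> C"
          unfolding h_def using F assms(1,4,6) by (intro C) auto
      qed
    qed (use h in \<open>auto simp: less_imp_le\<close>)
  qed
  then have "(\<lambda>i. norm (h i)) summable_on I"
    using h by (subst summable_on_cong[of I _ h]) (auto simp: less_imp_le)
  then have "countable {i\<in>I. h i \<noteq> 0}"
    by (rule abs_summable_countable)
  moreover have "{i\<in>I. h i \<noteq> 0} = I" using h by force
  ultimately show ?thesis by simp
qed

text \<open>The usual criterion holds although balls need not be open: openness in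
  \<open>qtopology\<close> only asks for some ball around each point.\<close>

lemma continuous_map_qtopology:
  assumes "\<And>x e. 0 < e \<Longrightarrow> \<exists>r>0. \<forall>y. d x y < r \<longrightarrow> cmod (f y - f x) < e"
  shows "continuous_map (qtopology d) euclidean f"
  unfolding continuous_map_def
proof (intro conjI allI impI)
  fix U :: "complex set" assume "openin euclidean U"
  then have U: "open U" by simp
  show "openin (qtopology d) {x \<in> topspace (qtopology d). f x \<in> U}"
    unfolding openin_qtopology
  proof (intro ballI)
    fix x assume "x \<in> {x \<in> topspace (qtopology d). f x \<in> U}"
    then obtain e where e: "0 < e" "\<And>w. dist w (f x) < e \<Longrightarrow> w \<in> U"
      using U by (auto simp: open_dist)
    obtain r where r: "0 < r" "\<And>y. d x y < r \<Longrightarrow> cmod (f y - f x) < e"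
      using assms[OF e(1)] by blast
    show "\<exists>r>0. qball d x r \<subseteq> {x \<in> topspace (qtopology d). f x \<in> U}"
      using r e by (intro exI[of _ r]) (auto simp: qball_def dist_norm)
  qed
qed simp

text \<open>Test functions thereby obey a kernel bound of scale 1 about x0, which makes the integral
  estimates for \<open>poly_size\<close> available to them.\<close>

lemma test_decay_eq: "test_decay d \<mu> x0 g x = poly_size d \<mu> g 1 x0 x"
  by (simp add: test_decay_def poly_size_def powr_divide powr_minus_divide)

text \<open>The definition of the test space does not mention measurability; it will follow from
  this continuity.\<close>

lemma continuous_map_test_space:
  assumes "0 < b" "\<phi> \<in> test_space d A0 \<mu> x0 b g"
  shows "continuous_map (qtopology d) euclidean \<phi>"
proof (rule continuous_map_qtopology)
  fix x e assume e: "0 < (e::real)"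
  obtain C where "test_bound d A0 \<mu> x0 b g \<phi> C" using assms by (auto simp: test_space_def)
  then have C: "0 < C" "\<And>x y. d x y \<le> (1 + d x0 x) / (2 * A0) \<Longrightarrow>
        cmod (\<phi> x - \<phi> y) \<le> C * (d x y / (1 + d x0 x)) powr b * test_decay d \<mu> x0 g x"
    by (auto simp: test_bound_def)
  define R where "R = 1 + d x0 x"
  have R: "0 < R" using d_nonneg[of x0 x] unfolding R_def by linarith
  define T where "T = C * test_decay d \<mu> x0 g x + 1"
  have T: "0 < T" using C by (auto simp: T_def test_decay_eq intro!: add_nonneg_pos)
  \<comment> \<open>The first term makes the regularity condition applicable, the second makes (d x
    y / R) powr b smaller than e / T.\<close>
  define r where "r = min (R / (2 * A0)) (R * (e / T) powr (1 / b))"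
  have r: "0 < r" using R e T A0_ge_1 by (simp add: r_def)
  show "\<exists>r>0. \<forall>y. d x y < r \<longrightarrow> cmod (\<phi> y - \<phi> x) < e"
  proof (intro exI conjI allI impI)
    fix y assume y: "d x y < r"
    then have "cmod (\<phi> x - \<phi> y) \<le> (d x y / R) powr b * (C * test_decay d \<mu> x0 g x)"
      using C(2)[of x y] by (simp add: r_def R_def mult_ac)
    also have "\<dots> \<le> (d x y / R) powr b * T"
      by (intro mult_left_mono) (auto simp: T_def)
    also have "(d x y / R) powr b < ((e / T) powr (1 / b)) powr b"
      using y R assms by (intro powr_less_mono2) (auto simp: r_def field_simps)
    also have "((e / T) powr (1 / b)) powr b = e / T"
      using e T assms by (simp add: powr_powr)
    finally show "cmod (\<phi> y - \<phi> x) < e"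
      using T by (simp add: norm_minus_commute)
  qed (rule r)
qed

text \<open>For fixed x the size condition is closed in the constant and so passes to the infimum
  defining the norm. Membership in the test space makes the set of admissible constants nonempty, as
  \<open>Inf\<close> demands.\<close>

lemma test_space_le_norm:
  assumes "\<phi> \<in> test_space d A0 \<mu> x0 b g"
  shows "0 \<le> test_norm d A0 \<mu> x0 b g \<phi>"
    and "cmod (\<phi> x) \<le> test_norm d A0 \<mu> x0 b g \<phi> * poly_size d \<mu> g 1 x0 x"
proof -
  define S where "S = {C. test_bound d A0 \<mu> x0 b g \<phi> C}"
  have S: "S \<noteq> {}" "\<And>C. C \<in> S \<Longrightarrow> 0 < C \<and> cmod (\<phi> x) \<le> C * poly_size d \<mu> g 1 x0 x" for x
    using assms by (auto simp: S_def test_space_def test_bound_def test_decay_eq)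
  show "0 \<le> test_norm d A0 \<mu> x0 b g \<phi>"
    unfolding test_norm_def S_def[symmetric] using S by (intro cInf_greatest) (auto simp: less_imp_le)
  have pos: "0 < poly_size d \<mu> g 1 x0 x" by (rule poly_size_pos) simp
  have "cmod (\<phi> x) / poly_size d \<mu> g 1 x0 x \<le> Inf S"
    using S(1) S(2)[of _ x] pos by (intro cInf_greatest) (auto simp: field_simps)
  then show "cmod (\<phi> x) \<le> test_norm d A0 \<mu> x0 b g \<phi> * poly_size d \<mu> g 1 x0 x"
    unfolding test_norm_def S_def[symmetric] using pos by (simp add: field_simps)
qed

end

section \<open>Dyadic cubes and measurability\<close>

locale dyadic_space = homogeneous_space d A0 \<mu> D
  for d :: "'a \<Rightarrow> 'a \<Rightarrow> real" and A0 \<mu> D +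
  fixes c0 C0 \<delta> :: real and \<A> :: "int \<Rightarrow> 'i set" and z :: "int \<Rightarrow> 'i \<Rightarrow> 'a" and Q :: "int \<Rightarrow> 'i \<Rightarrow> 'a set"
  assumes points: "dyadic_points d A0 c0 C0 \<delta> \<A> z"
    and cubes: "dyadic_cubes d A0 \<mu> c0 C0 \<delta> \<A> z Q"
begin

lemma constants: "0 < c0" "0 < C0" "0 < \<delta>" "\<delta> < 1"
  using points by (auto simp: dyadic_points_def)

lemma points_dense: "\<exists>\<alpha>\<in>\<A> k. d x (z k \<alpha>) < C0 * \<delta> powi k"
  using points by (simp add: dyadic_points_def)

lemma cube_measurable: "\<alpha> \<in> \<A> k \<Longrightarrow> Q k \<alpha> \<in> sets \<mu>"
  and cube_disjoint: "disjoint_family_on (Q k) (\<A> k)"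
  and cube_contains_ball: "\<alpha> \<in> \<A> k \<Longrightarrow> qball d (z k \<alpha>) (c0 * \<delta> powi k / (3 * A0\<^sup>2)) \<subseteq> Q k \<alpha>"
  and cube_subset_ball: "\<alpha> \<in> \<A> k \<Longrightarrow> Q k \<alpha> \<subseteq> qball d (z k \<alpha>) (2 * A0 * C0 * \<delta> powi k)"
  using cubes unfolding dyadic_cubes_def by blast+

lemma cube_radius: "\<alpha> \<in> \<A> k \<Longrightarrow> y \<in> Q k \<alpha> \<Longrightarrow> d (z k \<alpha>) y \<le> 2 * A0 * C0 * \<delta> powi k"
  using cube_subset_ball[of \<alpha> k] by (auto simp: qball_def)

lemma cube_diameter:
  assumes "\<alpha> \<in> \<A> k" "p \<in> Q k \<alpha>" "y \<in> Q k \<alpha>"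
  shows "d p y \<le> 4 * A0\<^sup>2 * C0 * \<delta> powi k"
proof -
  have "A0 * (d p (z k \<alpha>) + d (z k \<alpha>) y) \<le> A0 * (2 * A0 * C0 * \<delta> powi k + 2 * A0 * C0 * \<delta> powi k)"
    using cube_radius[OF assms(1,2)] cube_radius[OF assms(1,3)] A0_ge_1 d_sym[of p "z k \<alpha>"]
    by (intro mult_left_mono add_mono) auto
  then show ?thesis
    using d_triangle[of p y "z k \<alpha>"] by (simp add: power2_eq_square mult_ac)
qed

lemma cube_emeasure:
  assumes "\<alpha> \<in> \<A> k"
  shows "emeasure \<mu> (Q k \<alpha>) = ennreal (measure \<mu> (Q k \<alpha>))" "0 < measure \<mu> (Q k \<alpha>)"
proof -
  have "emeasure \<mu> (Q k \<alpha>) < \<infinity>"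
    using emeasure_mono[OF cube_subset_ball[OF assms], of \<mu>] emeasure_qball_finite
    by (auto intro: order_le_less_trans)
  then show eq: "emeasure \<mu> (Q k \<alpha>) = ennreal (measure \<mu> (Q k \<alpha>))"
    by (intro emeasure_eq_ennreal_measure) auto
  have "0 < V (c0 * \<delta> powi k / (3 * A0\<^sup>2)) (z k \<alpha>)"
    using constants A0_ge_1 by (intro V_pos) auto
  then have "0 < emeasure \<mu> (qball d (z k \<alpha>) (c0 * \<delta> powi k / (3 * A0\<^sup>2)))"
    by (simp add: emeasure_qball)
  also have "\<dots> \<le> emeasure \<mu> (Q k \<alpha>)"
    using cube_contains_ball[OF assms] cube_measurable[OF assms] by (intro emeasure_mono)
  finally show "0 < measure \<mu> (Q k \<alpha>)" by (simp add: eq)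
qed

lemma countable_indices: "countable (\<A> k)"
  using constants A0_ge_1 cube_disjoint cube_measurable cube_emeasure cube_radius
  by (intro countable_family[of "\<delta> powi k" "2 * A0 * C0" "Q k" _ "z k"]) auto

text \<open>An open set is at first an uncountable union of balls. The balls of radius C0 * \<delta>
  ^ k about dyadic points are countably many, since the index sets are countable, and each x in U
  lies in one of them that is contained in U.\<close>

lemma open_measurable:
  assumes "openin (qtopology d) U"
  shows "U \<in> sets \<mu>"
proof -
  define J where "J = (SIGMA k:UNIV. {\<alpha> \<in> \<A> (int k). qball d (z (int k) \<alpha>) (C0 * \<delta> ^ k) \<subseteq> U})"
  have "U = (\<Union>(k, \<alpha>)\<in>J. qball d (z (int k) \<alpha>) (C0 * \<delta> ^ k))"
  proof (intro equalityI subsetI)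
    fix x assume "x \<in> U"
    then obtain r where r: "0 < r" "qball d x r \<subseteq> U"
      using assms by (auto simp: openin_qtopology)
    \<comment> \<open>Every point of a ball of radius C0 * \<delta> ^ k that contains x has distance
      less than 2 * A0 * C0 * \<delta> ^ k from x; this decides the choice of k.\<close>
    have "0 < r / (2 * A0 * C0)" using r constants A0_ge_1 by simp
    then obtain k where "\<delta> ^ k < r / (2 * A0 * C0)"
      using real_arch_pow_inv[OF _ constants(4)] by blast
    then have k: "2 * A0 * C0 * \<delta> ^ k < r"
      using constants A0_ge_1 by (simp add: field_simps)
    obtain \<alpha> where \<alpha>: "\<alpha> \<in> \<A> (int k)" "d x (z (int k) \<alpha>) < C0 * \<delta> ^ k"
      using points_dense[of "int k" x] by auto
    have "qball d (z (int k) \<alpha>) (C0 * \<delta> ^ k) \<subseteq> qball d x r"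
    proof (clarsimp simp: qball_def)
      fix w assume "d (z (int k) \<alpha>) w < C0 * \<delta> ^ k"
      then have "A0 * (d x (z (int k) \<alpha>) + d (z (int k) \<alpha>) w) \<le> A0 * (C0 * \<delta> ^ k + C0 * \<delta> ^ k)"
        using \<alpha> A0_ge_1 by (intro mult_left_mono) auto
      then show "d x w < r"
        using k d_triangle[of x w "z (int k) \<alpha>"] by simp
    qed
    then show "x \<in> (\<Union>(k, \<alpha>)\<in>J. qball d (z (int k) \<alpha>) (C0 * \<delta> ^ k))"
      using \<alpha> r by (auto simp: J_def qball_def d_sym[of x] intro!: bexI[of _ "(k, \<alpha>)"])
  qed (auto simp: J_def)
  moreover have "countable J"
    unfolding J_def using countable_indices by (intro countable_SIGMA) (auto intro: countable_subset)
  ultimately show ?thesis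
    using sets.countable_UN'[of J "\<lambda>(k, \<alpha>). qball d (z (int k) \<alpha>) (C0 * \<delta> ^ k)" \<mu>]
    by (auto simp: case_prod_unfold)
qed

lemma continuous_map_measurable:
  fixes f :: "'a \<Rightarrow> complex"
  assumes "continuous_map (qtopology d) euclidean f"
  shows "f \<in> borel_measurable \<mu>"
proof (rule borel_measurableI)
  fix S :: "complex set" assume "open S"
  then have "openin (qtopology d) {x. f x \<in> S}"
    using assms by (simp add: continuous_map_def)
  then show "f -` S \<inter> space \<mu> \<in> sets \<mu>"
    using open_measurable by (simp add: space_eq vimage_def)
qed

text \<open>C bounds the integral of \<open>poly_size\<close> and is fixed before x0 and \<phi>, so
  that integration against a bounded function becomes continuous for the test norm.\<close>

lemma test_space_integrable:
  assumes "0 < b" "0 < g"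
  obtains C where "0 < C" "\<And>x0 \<phi>. \<phi> \<in> test_space d A0 \<mu> x0 b g \<Longrightarrow> integrable \<mu> \<phi>"
    "\<And>x0 \<phi>. \<phi> \<in> test_space d A0 \<mu> x0 b g \<Longrightarrow> (\<integral>x. cmod (\<phi> x) \<partial>\<mu>) \<le> C * test_norm d A0 \<mu> x0 b g \<phi>"
proof -
  obtain C where C: "0 < C" "\<And>r x M. 0 < r \<Longrightarrow> 0 \<le> M \<Longrightarrow>
    (\<integral>\<^sup>+y. ennreal (M * poly_size d \<mu> g r x y) \<partial>\<mu>) \<le> ennreal (M * C)"
    using nn_integral_poly_size[OF assms(2)] by blast
  have *: "integrable \<mu> \<phi> \<and> (\<integral>x. cmod (\<phi> x) \<partial>\<mu>) \<le> C * test_norm d A0 \<mu> x0 b g \<phi>"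
    if \<phi>: "\<phi> \<in> test_space d A0 \<mu> x0 b g" for x0 \<phi>
  proof -
    define n where "n = test_norm d A0 \<mu> x0 b g \<phi>"
    have n: "0 \<le> n" "\<And>x. cmod (\<phi> x) \<le> n * poly_size d \<mu> g 1 x0 x"
      unfolding n_def using test_space_le_norm[OF \<phi>] by auto
    have meas [measurable]: "\<phi> \<in> borel_measurable \<mu>"
      using assms \<phi> by (intro continuous_map_measurable continuous_map_test_space)
    have "(\<integral>\<^sup>+x. ennreal (cmod (\<phi> x)) \<partial>\<mu>) \<le> (\<integral>\<^sup>+x. ennreal (n * poly_size d \<mu> g 1 x0 x) \<partial>\<mu>)"
      using n by (intro nn_integral_mono ennreal_leI) auto
    also have "\<dots> \<le> ennreal (n * C)" using n by (intro C) auto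
    finally have le: "(\<integral>\<^sup>+x. ennreal (cmod (\<phi> x)) \<partial>\<mu>) \<le> ennreal (n * C)" .
    then have int: "integrable \<mu> \<phi>"
      by (intro integrableI_bounded meas) (auto intro: order_le_less_trans)
    have "ennreal (\<integral>x. cmod (\<phi> x) \<partial>\<mu>) \<le> ennreal (n * C)"
      using int le by (subst nn_integral_eq_integral[symmetric]) auto
    then show ?thesis using int n C by (simp add: n_def mult.commute)
  qed
  show ?thesis using that[OF C(1)] * by blast
qed

end

section \<open>Series and sampling over cubes\<close>

lemma infsum_bounded:
  fixes f :: "'i \<Rightarrow> complex"
  assumes "\<And>F. finite F \<Longrightarrow> F \<subseteq> I \<Longrightarrow> (\<Sum>i\<in>F. cmod (f i)) \<le> B"
  shows "f summable_on I" "cmod (infsum f I) \<le> B"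
proof -
  have "(\<lambda>i. cmod (f i)) summable_on I"
    using assms by (intro nonneg_bdd_above_summable_on) (auto intro!: bdd_aboveI2[where M = B])
  note sm = this
  show "f summable_on I" by (rule abs_summable_summable[OF sm])
  show "cmod (infsum f I) \<le> B"
    using norm_infsum_bound[OF sm] infsum_le_finite_sums[OF sm assms] by linarith
qed

text \<open>\<open>infsum\<close> is a limit along the net of finite subsets, whereas dominated
  convergence needs a sequence. For countable I one cofinal sequence of finite sets serves all
  families at once.\<close>

lemma countable_exhaustion_infsum:
  assumes "countable I"
  obtains F :: "nat \<Rightarrow> 'i set" where "\<forall>n. finite (F n)" "\<forall>n. F n \<subseteq> I"
    "\<forall>f :: 'i \<Rightarrow> complex. f summable_on I \<longrightarrow> (\<lambda>n. sum f (F n)) \<longlonglongrightarrow> infsum f I"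
proof
  define F where "F n = {i \<in> I. to_nat_on I i < n}" for n
  have fin: "finite (F n)" for n
  proof (rule finite_imageD)
    show "finite (to_nat_on I ` F n)"
      by (rule finite_subset[of _ "{..<n}"]) (auto simp: F_def)
    show "inj_on (to_nat_on I) (F n)"
      using inj_on_to_nat_on[OF assms] by (rule inj_on_subset) (auto simp: F_def)
  qed
  then show "\<forall>n. finite (F n)" "\<forall>n. F n \<subseteq> I" by (auto simp: F_def)
  have lim: "filterlim F (finite_subsets_at_top I) sequentially"
    unfolding filterlim_finite_subsets_at_top
  proof safe
    fix X assume X: "finite X" "X \<subseteq> I"
    then obtain m where "to_nat_on I ` X \<subseteq> {..<m}"
      by (meson finite_imageI finite_nat_iff_bounded)
    then have "finite (F n) \<and> X \<subseteq> F n \<and> F n \<subseteq> I" if "m \<le> n" for n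
      using fin X that by (fastforce simp: F_def)
    then show "\<forall>\<^sub>F n in sequentially. finite (F n) \<and> X \<subseteq> F n \<and> F n \<subseteq> I"
      by (auto simp: eventually_sequentially)
  qed
  show "\<forall>f :: 'i \<Rightarrow> complex. f summable_on I \<longrightarrow> (\<lambda>n. sum f (F n)) \<longlonglongrightarrow> infsum f I"
    using filterlim_compose[OF has_sum_infsum[unfolded has_sum_def] lim] by blast
qed

lemma integrable_bounded_mult:
  fixes h \<phi> :: "'a \<Rightarrow> complex"
  assumes \<phi>: "integrable M \<phi>" and h [measurable]: "h \<in> borel_measurable M" and B: "\<And>x. cmod (h x) \<le> B"
  shows "integrable M (\<lambda>x. h x * \<phi> x)"
proof (rule Bochner_Integration.integrable_bound)
  show "integrable M (\<lambda>x. B * cmod (\<phi> x))" using \<phi> by auto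
  have [measurable]: "\<phi> \<in> borel_measurable M" using \<phi> by auto
  show "(\<lambda>x. h x * \<phi> x) \<in> borel_measurable M" by measurable
  have "cmod (h x * \<phi> x) \<le> norm (B * cmod (\<phi> x))" for x
    by (auto simp: norm_mult abs_mult intro!: mult_right_mono order_trans[OF B abs_ge_self])
  then show "AE x in M. cmod (h x * \<phi> x) \<le> norm (B * cmod (\<phi> x))" by simp
qed

text \<open>Dominated convergence along the exhaustion, with majorant B * cmod (\<phi> x). The
  assumption \<open>sm\<close> links the \<open>infsum\<close> of the integrals to its partial sums;
  for non-summable families \<open>infsum\<close> is 0 by default.\<close>

lemma infsum_integral_mult:
  fixes T :: "'i \<Rightarrow> 'a \<Rightarrow> complex"
  assumes "countable I" and T: "\<And>i. i \<in> I \<Longrightarrow> T i \<in> borel_measurable M"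
    and B: "\<And>F x. finite F \<Longrightarrow> F \<subseteq> I \<Longrightarrow> (\<Sum>i\<in>F. cmod (T i x)) \<le> B"
    and \<phi>: "integrable M \<phi>"
    and sm: "(\<lambda>i. \<integral>x. T i x * \<phi> x \<partial>M) summable_on I"
  shows "infsum (\<lambda>i. \<integral>x. T i x * \<phi> x \<partial>M) I = (\<integral>x. infsum (\<lambda>i. T i x) I * \<phi> x \<partial>M)"
    and "(\<lambda>x. infsum (\<lambda>i. T i x) I) \<in> borel_measurable M"
proof -
  obtain F :: "nat \<Rightarrow> 'i set" where F: "\<And>n. finite (F n)" "\<And>n. F n \<subseteq> I"
    and lim: "\<And>f :: 'i \<Rightarrow> complex. f summable_on I \<Longrightarrow> (\<lambda>n. sum f (F n)) \<longlonglongrightarrow> infsum f I"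
    using countable_exhaustion_infsum[OF assms(1)] by metis
  have [measurable]: "\<phi> \<in> borel_measurable M" using \<phi> by auto
  have Tx: "(\<lambda>i. T i x) summable_on I" for x
    by (rule infsum_bounded[of _ _ B]) (rule B)
  show G [measurable]: "(\<lambda>x. infsum (\<lambda>i. T i x) I) \<in> borel_measurable M"
    using F T by (intro borel_measurable_LIMSEQ_metric[OF _ lim[OF Tx]] borel_measurable_sum) auto
  have int: "integrable M (\<lambda>x. T i x * \<phi> x)" if "i \<in> I" for i
    using B[of "{i}"] that by (intro integrable_bounded_mult[OF \<phi> T[OF that], of B]) simp
  have "(\<lambda>n. \<integral>x. (\<Sum>i\<in>F n. T i x) * \<phi> x \<partial>M) \<longlonglongrightarrow> (\<integral>x. infsum (\<lambda>i. T i x) I * \<phi> x \<partial>M)"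
  proof (rule integral_dominated_convergence)
    show "integrable M (\<lambda>x. B * cmod (\<phi> x))" using \<phi> by auto
    show "AE x in M. (\<lambda>n. (\<Sum>i\<in>F n. T i x) * \<phi> x) \<longlonglongrightarrow> infsum (\<lambda>i. T i x) I * \<phi> x"
      using lim[OF Tx] by (intro always_eventually allI tendsto_mult tendsto_const)
    have "cmod (\<Sum>i\<in>F n. T i x) \<le> B" for n x
      using sum_norm_le[of "F n" "\<lambda>i. T i x" "\<lambda>i. cmod (T i x)"] B[OF F, of x n] by simp
    then show "AE x in M. cmod ((\<Sum>i\<in>F n. T i x) * \<phi> x) \<le> B * cmod (\<phi> x)" for n
      by (auto simp: norm_mult intro!: mult_right_mono)
    show "(\<lambda>x. (\<Sum>i\<in>F n. T i x) * \<phi> x) \<in> borel_measurable M" for n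
      using F T by (intro borel_measurable_times borel_measurable_sum) auto
  qed measurable
  moreover have "(\<integral>x. (\<Sum>i\<in>F n. T i x) * \<phi> x \<partial>M) = (\<Sum>i\<in>F n. \<integral>x. T i x * \<phi> x \<partial>M)" for n
    using F int by (subst Bochner_Integration.integral_sum[symmetric]) (auto simp: sum_distrib_right)
  ultimately have "(\<lambda>n. \<Sum>i\<in>F n. \<integral>x. T i x * \<phi> x \<partial>M) \<longlonglongrightarrow> (\<integral>x. infsum (\<lambda>i. T i x) I * \<phi> x \<partial>M)"
    by simp
  with lim[OF sm] show "infsum (\<lambda>i. \<integral>x. T i x * \<phi> x \<partial>M) I = (\<integral>x. infsum (\<lambda>i. T i x) I * \<phi> x \<partial>M)"
    by (rule LIMSEQ_unique)
qed

text \<open>Split where \<delta> ^ n is about t. From n on, the first bound is geometric and its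
  leading term is at most M * t powr s, with s > 0 giving convergence. Before n, the second bound
  grows geometrically in k as s < b, so it is dominated by its last term, again of order M * t powr
  s.\<close>

lemma two_scale_series:
  fixes \<delta> s b :: real
  assumes "0 < \<delta>" "\<delta> < 1" "0 < s" "s < b"
  obtains C where "0 < C" "\<And>M t (u :: nat \<Rightarrow> real). 0 \<le> M \<Longrightarrow> 0 < t \<Longrightarrow> (\<forall>k. 0 \<le> u k) \<Longrightarrow>
     (\<forall>k. u k \<le> M * (\<delta> powr s) ^ k) \<Longrightarrow> (\<forall>k. u k \<le> M * (\<delta> powr s) ^ k * (t / \<delta> ^ k) powr b) \<Longrightarrow>
     suminf u \<le> M * C * t powr s"
proof
  define p where "p = \<delta> powr s"
  define q where "q = \<delta> powr (b - s)"
  have p: "0 < p" "p < 1" using assms powr_less_mono2[of s \<delta> 1] by (auto simp: p_def)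
  have q: "0 < q" "q < 1" using assms powr_less_mono2[of "b - s" \<delta> 1] by (auto simp: q_def)
  show "0 < 1 / (1 - p) + 1 / (1 - q)" using p q by (intro add_pos_pos) auto
  fix M t and u :: "nat \<Rightarrow> real"
  assume M: "0 \<le> (M::real)" and t: "0 < (t::real)" and u: "\<forall>k. 0 \<le> u k"
    "\<forall>k. u k \<le> M * (\<delta> powr s) ^ k" "\<forall>k. u k \<le> M * (\<delta> powr s) ^ k * (t / \<delta> ^ k) powr b"
  have pk: "p ^ k = (\<delta> ^ k) powr s" for k
    using assms by (simp add: p_def powr_powr mult.commute flip: powr_realpow)
  have qk: "q ^ k = (\<delta> ^ k) powr (b - s)" for k
    using assms by (simp add: q_def powr_powr mult.commute flip: powr_realpow)
  \<comment> \<open>The least such n; for t \<ge> 1 it is 0 and the sum over k < n is empty.\<close>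
  obtain n where n: "\<delta> ^ n \<le> t" "\<And>m. m < n \<Longrightarrow> t < \<delta> ^ m"
  proof -
    have "\<exists>n. \<delta> ^ n \<le> t" using real_arch_pow_inv[OF t assms(2)] less_imp_le by blast
    then show ?thesis using exists_least_iff[of "\<lambda>n. \<delta> ^ n \<le> t"] that by (auto simp: not_le)
  qed
  have geo: "summable (\<lambda>k. M * p ^ k)" using p by (intro summable_mult summable_geometric) auto
  have sm: "summable u"
    by (rule summable_comparison_test'[OF geo, of 0]) (use u in \<open>auto simp: p_def\<close>)
  have "(\<Sum>k. u (k + n)) \<le> (\<Sum>k. M * p ^ n * p ^ k)"
  proof (intro suminf_le summable_ignore_initial_segment[OF sm] summable_mult summable_geometric)
    show "u (k + n) \<le> M * p ^ n * p ^ k" for k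
      using u(2)[rule_format, of "k + n"] by (simp add: p_def power_add mult_ac)
  qed (use p in auto)
  also have "\<dots> = M * p ^ n / (1 - p)"
    using p by (subst suminf_mult) (auto simp: suminf_geometric summable_geometric)
  also have "\<dots> \<le> M * t powr s / (1 - p)"
    unfolding pk using n assms p M by (intro divide_right_mono mult_left_mono powr_mono2) auto
  finally have 1: "(\<Sum>k. u (k + n)) \<le> M * t powr s / (1 - p)" .
  have "(\<Sum>k<n. u k) \<le> (\<Sum>k<n. M * t powr s * q ^ (n - Suc k))"
  proof (rule sum_mono)
    fix k assume "k \<in> {..<n}"
    then have k: "k < n" by simp
    \<comment> \<open>Minimality of n, applied to n - 1, gives t < \<delta> ^ (n - 1); the
      subtraction is genuine because k < n.\<close>
    have "t powr (b - s) \<le> q ^ (n - 1)"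
      unfolding qk using n(2)[of "n - 1"] k t assms by (intro powr_mono2) auto
    also have "q ^ (n - 1) = q ^ k * q ^ (n - Suc k)"
      using k by (simp flip: power_add)
    finally have A: "t powr (b - s) / q ^ k \<le> q ^ (n - Suc k)"
      using q by (simp add: field_simps)
    have B: "p ^ k * (t / \<delta> ^ k) powr b = t powr s * (t powr (b - s) / q ^ k)"
      using t assms by (simp add: pk qk powr_divide powr_diff field_simps)
    have "p ^ k * (t / \<delta> ^ k) powr b \<le> t powr s * q ^ (n - Suc k)"
      unfolding B by (intro mult_left_mono A powr_ge_zero)
    then have "M * (p ^ k * (t / \<delta> ^ k) powr b) \<le> M * (t powr s * q ^ (n - Suc k))"
      using M by (rule mult_left_mono)
    then show "u k \<le> M * t powr s * q ^ (n - Suc k)"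
      using order_trans[OF u(3)[rule_format, of k]] by (simp add: p_def mult.assoc)
  qed
  also have "\<dots> = M * t powr s * (\<Sum>k<n. q ^ k)"
    by (simp add: sum_distrib_left sum.nat_diff_reindex[of "\<lambda>k. M * t powr s * q ^ k"])
  also have "(\<Sum>k<n. q ^ k) \<le> 1 / (1 - q)"
    using q sum_le_suminf[of "\<lambda>k. q ^ k" "{..<n}"] by (simp add: suminf_geometric summable_geometric)
  finally have 2: "(\<Sum>k<n. u k) \<le> M * t powr s * (1 / (1 - q))"
    using M by (simp add: mult_left_mono)
  show "suminf u \<le> M * (1 / (1 - p) + 1 / (1 - q)) * t powr s"
    using 1 2 suminf_split_initial_segment[OF sm, of n] by (simp add: algebra_simps)
qed

text \<open>The reproducing formula tests its kernel by an integral over E for k = 0 and by a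
  weighted point value for k > 0. Treating both as one functional of h separates, in
  \<open>repr_term_eq\<close>, the dependence on x from the coefficient taken from f.\<close>

definition sample :: "'a measure \<Rightarrow> nat \<Rightarrow> 'a set \<Rightarrow> 'a \<Rightarrow> ('a \<Rightarrow> complex) \<Rightarrow> complex" where
  "sample \<mu> k E p h = (if k = 0 then LINT y:E|\<mu>. h y else of_real (measure \<mu> E) * h p)"

lemma repr_term_eq:
  "repr_term \<mu> N k K K' E p f x = sample \<mu> k E p (K' x) *
     (if k \<le> N then mean_on \<mu> E (distr_op K f) else distr_op K f p)"
  by (simp add: repr_term_def sample_def)

context dyadic_space
begin

section \<open>Sampling over the subcubes of one scale\<close>

text \<open>This is the index set I k of the inner sum in \<open>reproducing_formula\<close>, so
  unfolding it matches the formula literally.\<close>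

definition level :: "nat \<Rightarrow> nat \<Rightarrow> ('i \<times> 'i) set" where
  "level j0 k = (SIGMA \<alpha>:\<A> (int k). subcubes \<A> Q j0 k \<alpha>)"

definition subcube :: "nat \<Rightarrow> nat \<Rightarrow> 'i \<times> 'i \<Rightarrow> 'a set" where
  "subcube j0 k i = Q (int (k + j0)) (snd i)"

lemma level_index: "i \<in> level j0 k \<Longrightarrow> snd i \<in> \<A> (int (k + j0))"
  by (auto simp: level_def subcubes_def)

lemma cube_nonempty: "\<alpha> \<in> \<A> k \<Longrightarrow> Q k \<alpha> \<noteq> {}"
  using cube_emeasure(2) by fastforce

text \<open>Different \<tau> give different cubes of one generation. The same \<tau> below two
  different parents would lie in their empty intersection.\<close>

lemma subcube_disjoint: "disjoint_family_on (subcube j0 k) (level j0 k)"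
  unfolding disjoint_family_on_def
proof (intro ballI impI)
  fix i i' assume ii: "i \<in> level j0 k" "i' \<in> level j0 k" and ne': "i \<noteq> i'"
  obtain \<alpha> \<tau> \<alpha>' \<tau>' where eq: "i = (\<alpha>, \<tau>)" "i' = (\<alpha>', \<tau>')" by (cases i, cases i')
  note i = ii[unfolded eq] and ne = ne'[unfolded eq]
  show "subcube j0 k i \<inter> subcube j0 k i' = {}"
  proof (cases "\<tau> = \<tau>'")
    case True
    with ne have "\<alpha> \<noteq> \<alpha>'" by simp
    then have "Q (int k) \<alpha> \<inter> Q (int k) \<alpha>' = {}"
      using i cube_disjoint[of "int k"] by (auto simp: level_def disjoint_family_on_def)
    then show ?thesis using i unfolding eq by (auto simp: level_def subcubes_def subcube_def)
  next
    case False
    then show ?thesis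
      unfolding eq using i cube_disjoint[of "int (k + j0)"]
      by (auto simp: level_def subcubes_def subcube_def disjoint_family_on_def)
  qed
qed

lemma countable_level: "countable (level j0 k)"
  unfolding level_def by (intro countable_SIGMA countable_indices)
    (auto simp: subcubes_def intro: countable_subset[OF _ countable_indices])

lemma subcube_measurable [measurable]: "i \<in> level j0 k \<Longrightarrow> subcube j0 k i \<in> sets \<mu>"
  using cube_measurable[OF level_index] by (simp add: subcube_def)

lemma subcube_diameter:
  assumes "i \<in> level j0 k" "p \<in> subcube j0 k i" "y \<in> subcube j0 k i"
  shows "d p y \<le> 4 * A0\<^sup>2 * C0 * \<delta> ^ k"
proof -
  have "d p y \<le> 4 * A0\<^sup>2 * C0 * \<delta> ^ (k + j0)"
    using cube_diameter[OF level_index[OF assms(1)], of p y] assms(2,3) 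
    by (simp add: subcube_def power_int_of_nat flip: of_nat_add)
  also have "\<dots> \<le> 4 * A0\<^sup>2 * C0 * \<delta> ^ k"
    using constants A0_ge_1 by (intro mult_left_mono power_decreasing) auto
  finally show ?thesis .
qed

lemma integrable_poly_bound:
  assumes "0 < g" "0 < r" "h \<in> borel_measurable \<mu>" "0 \<le> M"
    "\<And>y. cmod (h y) \<le> M * poly_size d \<mu> g r x y"
  shows "integrable \<mu> h"
proof -
  obtain C where C: "0 < C" "\<And>r x M. 0 < r \<Longrightarrow> 0 \<le> M \<Longrightarrow>
    (\<integral>\<^sup>+y. ennreal (M * poly_size d \<mu> g r x y) \<partial>\<mu>) \<le> ennreal (M * C)"
    using nn_integral_poly_size[OF assms(1)] by blast
  have "(\<integral>\<^sup>+y. ennreal (cmod (h y)) \<partial>\<mu>) \<le> (\<integral>\<^sup>+y. ennreal (M * poly_size d \<mu> g r x y) \<partial>\<mu>)"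
    using assms by (intro nn_integral_mono ennreal_leI) auto
  also have "\<dots> \<le> ennreal (M * C)" using assms by (intro C)
  finally show ?thesis
    using assms by (intro integrableI_bounded) (auto intro: order_le_less_trans)
qed

text \<open>For k = 0 the sum is at most the integral of cmod (h y) over a disjoint union, which
  costs C1; for k > 0 it is a Riemann sum, which costs C2. The bound C1 + C2 serves all k.\<close>

lemma sum_sample_le:
  assumes "0 < g"
  obtains C where "0 < C" "\<And>k M x h p F. 0 \<le> M \<Longrightarrow> h \<in> borel_measurable \<mu> \<Longrightarrow>
     (\<forall>y. cmod (h y) \<le> M * poly_size d \<mu> g (\<delta> ^ k) x y) \<Longrightarrow>
     finite F \<Longrightarrow> F \<subseteq> level j0 k \<Longrightarrow> (\<forall>i\<in>F. p i \<in> subcube j0 k i) \<Longrightarrow>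
     (\<Sum>i\<in>F. cmod (sample \<mu> k (subcube j0 k i) (p i) h)) \<le> M * C"
proof -
  obtain C1 where C1: "0 < C1" "\<And>r x M. 0 < r \<Longrightarrow> 0 \<le> M \<Longrightarrow>
    (\<integral>\<^sup>+y. ennreal (M * poly_size d \<mu> g r x y) \<partial>\<mu>) \<le> ennreal (M * C1)"
    using nn_integral_poly_size[OF assms] by blast
  have c: "0 \<le> 4 * A0\<^sup>2 * C0" using constants by simp
  show ?thesis
  proof (rule sum_measure_poly_size[OF assms c, where ?'b = "'i \<times> 'i"])
    fix C2 assume C2: "0 < C2" "\<And>r x F (E :: 'i \<times> 'i \<Rightarrow> 'a set) p. 0 < r \<Longrightarrow> finite F \<Longrightarrow>
      disjoint_family_on E F \<Longrightarrow> \<forall>i\<in>F. E i \<in> sets \<mu> \<Longrightarrow>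
      \<forall>i\<in>F. \<forall>y\<in>E i. d (p i) y \<le> 4 * A0\<^sup>2 * C0 * r \<Longrightarrow>
      (\<Sum>i\<in>F. measure \<mu> (E i) * poly_size d \<mu> g r x (p i)) \<le> C2"
    show ?thesis
    proof (rule that)
      show "0 < C1 + C2" using C1 C2 by simp
      fix k M x h p F
      assume M: "0 \<le> (M::real)" and h [measurable]: "h \<in> borel_measurable \<mu>"
        and hM: "\<forall>y. cmod (h y) \<le> M * poly_size d \<mu> g (\<delta> ^ k) x y"
        and F: "finite F" "F \<subseteq> level j0 k" and p: "\<forall>i\<in>F. p i \<in> subcube j0 k i"
      have r: "0 < \<delta> ^ k" using constants by simp
      have disj: "disjoint_family_on (subcube j0 k) F"
        using subcube_disjoint F by (auto intro: disjoint_family_on_mono)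
      have E: "subcube j0 k i \<in> sets \<mu>" if "i \<in> F" for i
        using that F subcube_measurable by blast
      have int: "integrable \<mu> h"
        by (rule integrable_poly_bound[OF assms r h M]) (use hM in auto)
      show "(\<Sum>i\<in>F. cmod (sample \<mu> k (subcube j0 k i) (p i) h)) \<le> M * (C1 + C2)"
      proof (cases "k = 0")
        case True
        have intE: "set_integrable \<mu> (subcube j0 k i) (\<lambda>y. cmod (h y))" if "i \<in> F" for i
          using E[OF that] int by (intro integrable_mult_indicator[folded set_integrable_def]) auto
        have "(\<Sum>i\<in>F. cmod (sample \<mu> k (subcube j0 k i) (p i) h))
            \<le> (\<Sum>i\<in>F. LINT y:subcube j0 k i|\<mu>. cmod (h y))"
          unfolding sample_def using True E int
          by (auto intro!: sum_mono set_integral_norm_bound integrable_mult_indicator[folded set_integrable_def])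
        also have "\<dots> = (LINT y:(\<Union>i\<in>F. subcube j0 k i)|\<mu>. cmod (h y))"
          using set_integral_finite_Union[OF F(1) disj intE E] by simp
        also have "\<dots> \<le> (\<integral>y. cmod (h y) \<partial>\<mu>)"
          using int E F unfolding set_lebesgue_integral_def
          by (intro integral_mono integrable_mult_indicator) (auto simp: indicator_def)
        also have "ennreal (\<integral>y. cmod (h y) \<partial>\<mu>) \<le> ennreal (M * C1)"
        proof -
          have "ennreal (\<integral>y. cmod (h y) \<partial>\<mu>) = (\<integral>\<^sup>+y. ennreal (cmod (h y)) \<partial>\<mu>)"
            using int by (intro nn_integral_eq_integral[symmetric]) auto
          also have "\<dots> \<le> (\<integral>\<^sup>+y. ennreal (M * poly_size d \<mu> g (\<delta> ^ k) x y) \<partial>\<mu>)"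
            using hM by (intro nn_integral_mono ennreal_leI) auto
          also have "\<dots> \<le> ennreal (M * C1)" by (rule C1(2)[OF r M])
          finally show ?thesis .
        qed
        then have "(\<integral>y. cmod (h y) \<partial>\<mu>) \<le> M * C1" using M C1 by simp
        also have "M * C1 \<le> M * (C1 + C2)" using M C2 by (intro mult_left_mono) auto
        finally show ?thesis .
      next
        case False
        have "(\<Sum>i\<in>F. cmod (sample \<mu> k (subcube j0 k i) (p i) h))
           \<le> (\<Sum>i\<in>F. M * (measure \<mu> (subcube j0 k i) * poly_size d \<mu> g (\<delta> ^ k) x (p i)))"
        proof (rule sum_mono)
          fix i
          have "measure \<mu> (subcube j0 k i) * cmod (h (p i))
             \<le> measure \<mu> (subcube j0 k i) * (M * poly_size d \<mu> g (\<delta> ^ k) x (p i))"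
            using hM by (intro mult_left_mono) auto
          then show "cmod (sample \<mu> k (subcube j0 k i) (p i) h)
             \<le> M * (measure \<mu> (subcube j0 k i) * poly_size d \<mu> g (\<delta> ^ k) x (p i))"
            using False by (simp add: sample_def norm_mult mult_ac)
        qed
        also have "\<dots> \<le> M * C2"
          unfolding sum_distrib_left[symmetric]
        proof (intro mult_left_mono M C2 r F disj)
          show "\<forall>i\<in>F. subcube j0 k i \<in> sets \<mu>" using E by blast
          show "\<forall>i\<in>F. \<forall>y\<in>subcube j0 k i. d (p i) y \<le> 4 * A0\<^sup>2 * C0 * \<delta> ^ k"
            using p F subcube_diameter by blast
        qed
        also have "M * C2 \<le> M * (C1 + C2)" using M C1 by (intro mult_left_mono) auto
        finally show ?thesis .
      qed
    qed
  qed
qed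

end

section \<open>From Hoelder to Besov\<close>

lemma AE_imp_ex_in_set:
  assumes "AE x in M. P x" "A \<in> sets M" "0 < emeasure M A"
  shows "\<exists>x\<in>A. P x"
proof (rule ccontr)
  assume "\<not> ?thesis"
  moreover obtain S where S: "{x \<in> space M. \<not> P x} \<subseteq> S" "emeasure M S = 0" "S \<in> sets M"
    using AE_E[OF assms(1)] by blast
  ultimately have "A \<subseteq> S"
    using sets.sets_into_space[OF assms(2)] by blast
  then show False
    using emeasure_mono[OF _ S(3), of A] S(2) assms(3) by simp
qed

lemma nn_integral_cmod_imp_bound:
  assumes "h \<in> borel_measurable M" "0 \<le> B" "(\<integral>\<^sup>+x. ennreal (cmod (h x)) \<partial>M) \<le> ennreal B"
  shows "integrable M h" "cmod (\<integral>x. h x \<partial>M) \<le> B"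
proof -
  show int: "integrable M h"
    using assms by (intro integrableI_bounded) (auto intro: order_le_less_trans)
  have "ennreal (cmod (\<integral>x. h x \<partial>M)) \<le> ennreal B"
    using integral_norm_bound_ennreal[OF int] assms(3) by simp
  then show "cmod (\<integral>x. h x \<partial>M) \<le> B" using assms(2) by simp
qed

context dyadic_space
begin

text \<open>The essential supremum only bounds f almost everywhere. By continuity a violation at one
  point would persist on a ball, and balls have positive measure; so the bound holds at every
  point.\<close>

lemma hoelder_spaceD:
  assumes "f \<in> hoelder_space d \<mu> s"
  obtains H where "0 \<le> H" "hoelder_norm d \<mu> s f = ennreal H" "f \<in> borel_measurable \<mu>"
    "\<And>x. cmod (f x) \<le> H" "\<And>x y. cmod (f x - f y) \<le> H * d x y powr s"
proof -
  have cont: "continuous_map (qtopology d) euclidean f" and fin: "hoelder_norm d \<mu> s f < \<infinity>"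
    using assms by (auto simp: hoelder_space_def)
  have meas: "f \<in> borel_measurable \<mu>" by (rule continuous_map_measurable[OF cont])
  obtain H where H: "0 \<le> H" "hoelder_norm d \<mu> s f = ennreal H"
    using fin by (cases "hoelder_norm d \<mu> s f") auto
  have "(SUP (x, y)\<in>{(x, y). x \<noteq> y}. ennreal (cmod (f x - f y) / d x y powr s)) \<le> ennreal H"
    unfolding H(2)[symmetric] hoelder_norm_def by simp
  then have quot: "ennreal (cmod (f x - f y) / d x y powr s) \<le> ennreal H" if "x \<noteq> y" for x y
    using that by (auto simp: SUP_le_iff)
  have dist: "cmod (f x - f y) \<le> H * d x y powr s" for x y
  proof (cases "x = y")
    case False
    then have "cmod (f x - f y) / d x y powr s \<le> H" using quot H by simp
    then show ?thesis using False by (simp add: pos_divide_le_eq)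
  qed (use H in simp)
  have "Linf_norm \<mu> f \<le> ennreal H"
    unfolding H(2)[symmetric] hoelder_norm_def by simp
  then have "AE x in \<mu>. ennreal (cmod (f x)) \<le> ennreal H"
    using esssup_AE[of "\<lambda>x. ennreal (cmod (f x))" \<mu>] unfolding Linf_norm_def
    by (auto elim: eventually_mono)
  then have AE: "AE x in \<mu>. cmod (f x) \<le> H" using H by simp
  have bound: "cmod (f x) \<le> H" for x
  proof (rule ccontr)
    assume "\<not> ?thesis"
    then have x: "f x \<in> {w. H < cmod w}" by simp
    have op: "open {w. H < cmod w}" by (intro open_Collect_less continuous_intros)
    have "openin (qtopology d) {y. f y \<in> {w. H < cmod w}}"
      using openin_continuous_map_preimage[OF cont, of "{w. H < cmod w}"] op by simp
    then obtain r where r: "0 < r" "qball d x r \<subseteq> {y. H < cmod (f y)}"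
      using x by (auto simp: openin_qtopology)
    have "0 < emeasure \<mu> (qball d x r)" using V_pos[OF r(1)] by (simp add: emeasure_qball)
    then show False
      using AE_imp_ex_in_set[OF AE qball_measurable] r(2) by fastforce
  qed
  show ?thesis by (rule that[OF H meas bound dist])
qed

lemma hoelder_spaceI:
  assumes "0 < s" "0 \<le> B" "0 \<le> L" "\<And>x. cmod (f x) \<le> B" "\<And>x y. cmod (f x - f y) \<le> L * d x y powr s"
  shows "f \<in> hoelder_space d \<mu> s" "hoelder_norm d \<mu> s f \<le> ennreal (L + B)"
proof -
  have cont: "continuous_map (qtopology d) euclidean f"
  proof (rule continuous_map_qtopology)
    fix x e assume e: "0 < (e::real)"
    \<comment> \<open>L may be 0, so the divisor is L + 1.\<close>
    define r where "r = (e / (L + 1)) powr (1 / s)"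
    have "0 < r" using e assms by (simp add: r_def)
    moreover have "cmod (f y - f x) < e" if y: "d x y < r" for y
    proof -
      have "d x y powr s < r powr s" using y assms by (intro powr_less_mono2) auto
      also have "r powr s = e / (L + 1)" using e assms by (simp add: r_def powr_powr)
      finally have *: "(L + 1) * d x y powr s < e" using assms by (simp add: field_simps)
      have "cmod (f y - f x) \<le> L * d x y powr s"
        using assms(5)[of x y] by (simp add: norm_minus_commute)
      also have "\<dots> \<le> (L + 1) * d x y powr s" by (intro mult_right_mono) auto
      finally show ?thesis using * by simp
    qed
    ultimately show "\<exists>r>0. \<forall>y. d x y < r \<longrightarrow> cmod (f y - f x) < e" by blast
  qed
  have [measurable]: "f \<in> borel_measurable \<mu>" by (rule continuous_map_measurable[OF cont])
  have "(SUP (x, y)\<in>{(x, y). x \<noteq> y}. ennreal (cmod (f x - f y) / d x y powr s)) \<le> ennreal L"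
  proof (intro SUP_least, clarify)
    fix x y :: 'a assume "x \<noteq> y"
    then show "ennreal (cmod (f x - f y) / d x y powr s) \<le> ennreal L"
      using assms(5)[of x y] d_pos[of x y] by (intro ennreal_leI) (simp add: field_simps)
  qed
  moreover have "Linf_norm \<mu> f \<le> ennreal B"
    unfolding Linf_norm_def using assms(4) by (intro esssup_I) (auto intro: ennreal_leI)
  ultimately show "hoelder_norm d \<mu> s f \<le> ennreal (L + B)"
    unfolding hoelder_norm_def using assms by (simp add: add_mono)
  then show "f \<in> hoelder_space d \<mu> s"
    using cont by (auto simp: hoelder_space_def intro: order_le_less_trans)
qed

lemma bounded_fun_distribution:
  assumes "0 < b" "0 < g" and f: "f \<in> borel_measurable \<mu>" "\<And>x. cmod (f x) \<le> H"
  shows "fun_distr \<mu> f \<in> distributions d A0 \<mu> x0 \<eta> b g"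
proof -
  obtain C where C: "0 < C" "\<And>x0 \<phi>. \<phi> \<in> test_space d A0 \<mu> x0 b g \<Longrightarrow> integrable \<mu> \<phi>"
    "\<And>x0 \<phi>. \<phi> \<in> test_space d A0 \<mu> x0 b g \<Longrightarrow> (\<integral>x. cmod (\<phi> x) \<partial>\<mu>) \<le> C * test_norm d A0 \<mu> x0 b g \<phi>"
    using test_space_integrable[OF assms(1,2)] by metis
  let ?G = "test_space0 d A0 \<mu> x0 \<eta> b g"
  have sub: "\<phi> \<in> test_space d A0 \<mu> x0 b g" if "\<phi> \<in> ?G" for \<phi>
    using that by (simp add: test_space0_def)
  have int: "integrable \<mu> (\<lambda>x. f x * \<phi> x)" if "\<phi> \<in> ?G" for \<phi>
    using C(2)[OF sub[OF that]] f by (rule integrable_bounded_mult)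
  have H: "0 \<le> H" using f(2)[of x0] norm_ge_zero order_trans by blast
  have "cmod (fun_distr \<mu> f \<phi>) \<le> H * C * test_norm d A0 \<mu> x0 b g \<phi>" if "\<phi> \<in> ?G" for \<phi>
  proof -
    have "cmod (fun_distr \<mu> f \<phi>) \<le> (\<integral>x. H * cmod (\<phi> x) \<partial>\<mu>)"
      unfolding fun_distr_def
      using int[OF that] C(2)[OF sub[OF that]] f(2)
      by (intro order_trans[OF integral_norm_bound] integral_mono integrable_norm)
        (auto simp: norm_mult mult_right_mono)
    also have "\<dots> \<le> H * (C * test_norm d A0 \<mu> x0 b g \<phi>)"
      using C(3)[OF sub[OF that]] H by (simp add: mult_left_mono)
    finally show ?thesis by simp
  qed
  moreover have "fun_distr \<mu> f (\<lambda>x. \<phi> x + \<psi> x) = fun_distr \<mu> f \<phi> + fun_distr \<mu> f \<psi>"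
    if "\<phi> \<in> ?G" "\<psi> \<in> ?G" for \<phi> \<psi>
    using int that by (simp add: fun_distr_def ring_distribs)
  moreover have "fun_distr \<mu> f (\<lambda>x. c * \<phi> x) = c * fun_distr \<mu> f \<phi>" for c \<phi>
    by (simp add: fun_distr_def mult.left_commute)
  ultimately show ?thesis unfolding distributions_def Let_def by blast
qed

text \<open>Bounding \<open>exp_gap\<close> by 1 brings the scales k \<ge> 1 under the same size
  estimate as k = 0, so one constant covers mass and s-th moment of all the kernels.\<close>

lemma exp_IATI_integral_bound:
  assumes K: "exp_IATI d \<mu> \<delta> \<A> z \<eta> K" and s: "0 < s" "s \<le> 1"
  obtains C where "0 < C" "\<And>k x M. 0 \<le> M \<Longrightarrow>
    (\<integral>\<^sup>+y. ennreal (M * (cmod (K k x y) * (1 + (d x y / \<delta> ^ k) powr s))) \<partial>\<mu>) \<le> ennreal (M * C)"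
proof -
  obtain c \<nu> a where c: "0 < c" "0 < \<nu>" "0 < a" "a \<le> 1"
    and K0: "kernel_estimates d 1 \<eta> (\<lambda>x y. c * exp_size d \<mu> \<delta> \<nu> a 0 x y) (K 0)"
    and K1: "\<And>k. k \<ge> 1 \<Longrightarrow> kernel_estimates d (\<delta> ^ k) \<eta>
           (\<lambda>x y. c * (exp_size d \<mu> \<delta> \<nu> a k x y *
              exp_gap d \<delta> (new_points \<A> z (int k)) \<nu> a k x y)) (K k)"
    using K unfolding exp_IATI_def by auto
  have size: "0 \<le> exp_size d \<mu> \<delta> \<nu> a k x y" for k x y
    by (simp add: exp_size_def)
  have gap: "exp_gap d \<delta> Y \<nu> a k x y \<le> 1" for Y k x y
    using c by (simp add: exp_gap_def)
  have bound: "cmod (K k x y) \<le> c * exp_size d \<mu> \<delta> \<nu> a k x y" for k x y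
  proof (cases "k = 0")
    case False
    then have "cmod (K k x y) \<le> c * (exp_size d \<mu> \<delta> \<nu> a k x y *
              exp_gap d \<delta> (new_points \<A> z (int k)) \<nu> a k x y)"
      using K1[of k] by (auto simp: kernel_estimates_def)
    also have "\<dots> \<le> c * (exp_size d \<mu> \<delta> \<nu> a k x y * 1)"
      using c size gap by (intro mult_left_mono) auto
    finally show ?thesis by simp
  qed (use K0 in \<open>auto simp: kernel_estimates_def\<close>)
  obtain C where C: "0 < C" "\<And>k x M. 0 \<le> M \<Longrightarrow>
    (\<integral>\<^sup>+y. ennreal (M * (exp_size d \<mu> \<delta> \<nu> a k x y * (1 + (d x y / \<delta> ^ k) powr s))) \<partial>\<mu>)
      \<le> ennreal (M * C)"
    using nn_integral_exp_size[OF constants(3) c(2,3) less_imp_le[OF s(1)] s(2)] by blast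
  show ?thesis
  proof
    show "0 < c * C" using c C by simp
    fix k x M assume M: "0 \<le> (M::real)"
    have "M * (cmod (K k x y) * (1 + (d x y / \<delta> ^ k) powr s))
        \<le> (M * c) * (exp_size d \<mu> \<delta> \<nu> a k x y * (1 + (d x y / \<delta> ^ k) powr s))" for y
      using mult_right_mono[OF bound[of k x y], of "1 + (d x y / \<delta> ^ k) powr s"] M
      by (simp add: mult.assoc mult_left_mono)
    then have "(\<integral>\<^sup>+y. ennreal (M * (cmod (K k x y) * (1 + (d x y / \<delta> ^ k) powr s))) \<partial>\<mu>)
      \<le> (\<integral>\<^sup>+y. ennreal ((M * c) * (exp_size d \<mu> \<delta> \<nu> a k x y * (1 + (d x y / \<delta> ^ k) powr s))) \<partial>\<mu>)"
      by (intro nn_integral_mono ennreal_leI)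
    also have "\<dots> \<le> ennreal (M * c * C)" using M c by (intro C) auto
    finally show "(\<integral>\<^sup>+y. ennreal (M * (cmod (K k x y) * (1 + (d x y / \<delta> ^ k) powr s))) \<partial>\<mu>)
      \<le> ennreal (M * (c * C))" by (simp add: mult.assoc)
  qed
qed

lemma kernel_section_measurable:
  assumes "case_prod K \<in> borel_measurable (\<mu> \<Otimes>\<^sub>M \<mu>)"
  shows "K x \<in> borel_measurable \<mu>" "(\<lambda>x. K x y) \<in> borel_measurable \<mu>"
  using measurable_compose[OF measurable_Pair1'[of x \<mu> \<mu>] assms]
    measurable_compose[OF measurable_Pair2'[of y \<mu> \<mu>] assms] by (simp_all add: space_eq)

text \<open>\<open>F1\<close> bounds the means on the scales k \<le> N, \<open>F2\<close> adds the
  decay demanded for k > N. Each contributes H * C to a norm that is a sum of two suprema, hence the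
  constant 2 * C.\<close>

theorem hoelder_imp_besov:
  assumes K: "exp_IATI d \<mu> \<delta> \<A> z \<eta> K" and s: "0 < s" "s \<le> 1" and bg: "0 < \<beta>" "0 < \<gamma>"
  shows "\<exists>C::real. 0 < C \<and> (\<forall>f\<in>hoelder_space d \<mu> s.
            fun_distr \<mu> f \<in> besov_space d A0 \<mu> x0 \<delta> \<A> Q j0 \<eta> K N \<beta> \<gamma> s \<and>
            besov_norm \<mu> \<delta> \<A> Q j0 K N s (fun_distr \<mu> f) \<le> ennreal C * hoelder_norm d \<mu> s f)"
proof -
  obtain C where C: "0 < C" "\<And>k x M. 0 \<le> M \<Longrightarrow>
    (\<integral>\<^sup>+y. ennreal (M * (cmod (K k x y) * (1 + (d x y / \<delta> ^ k) powr s))) \<partial>\<mu>) \<le> ennreal (M * C)"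
    using exp_IATI_integral_bound[OF K s] by metis
  have jm: "case_prod (K k) \<in> borel_measurable (\<mu> \<Otimes>\<^sub>M \<mu>)" for k
    using K by (auto simp: exp_IATI_def bounded_L2_kernel_def)
  note Kx [measurable] = kernel_section_measurable(1)[OF jm]
  have cancel: "(\<integral>y. K k x y \<partial>\<mu>) = 0" if "k \<ge> 1" for k x
    using K that by (simp add: exp_IATI_def)
  interpret sigma_finite_measure \<mu> by (rule sigma_finite)
  show ?thesis
  proof (intro exI conjI ballI)
    show "0 < 2 * C" using C by simp
    fix f assume "f \<in> hoelder_space d \<mu> s"
    then obtain H where H: "0 \<le> H" "hoelder_norm d \<mu> s f = ennreal H"
      and f [measurable]: "f \<in> borel_measurable \<mu>"
      and fH: "\<And>x. cmod (f x) \<le> H" "\<And>x y. cmod (f x - f y) \<le> H * d x y powr s"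
      by (rule hoelder_spaceD) blast
    have HC: "0 \<le> H * C" using H C by simp
    define F where "F k = distr_op (K k) (fun_distr \<mu> f)" for k
    have F: "F k x = (\<integral>y. f y * K k x y \<partial>\<mu>)" for k x
      by (simp add: F_def distr_op_def fun_distr_def)
    \<comment> \<open>\<open>esssup\<close> is \<open>top\<close> on non-measurable functions, so
      measurability in x must be shown; it follows from joint measurability of the kernel by
      Fubini.\<close>
    have Fm [measurable]: "F k \<in> borel_measurable \<mu>" for k
    proof -
      have "(\<lambda>(x, y). f y * K k x y) \<in> borel_measurable (\<mu> \<Otimes>\<^sub>M \<mu>)"
        using jm[of k] by measurable
      then have "(\<lambda>x. \<integral>y. f y * K k x y \<partial>\<mu>) \<in> borel_measurable \<mu>"
        by (rule borel_measurable_lebesgue_integral)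
      then show ?thesis by (simp add: F[abs_def])
    qed
    have F1: "integrable \<mu> (\<lambda>y. f y * K k x y) \<and> cmod (F k x) \<le> H * C" for k x
    proof -
      have "cmod (f y * K k x y) \<le> H * (cmod (K k x y) * (1 + (d x y / \<delta> ^ k) powr s))" for y
        using fH(1)[of y] H by (auto simp: norm_mult intro!: mult_mono)
          (simp add: algebra_simps)
      then have "(\<integral>\<^sup>+y. ennreal (cmod (f y * K k x y)) \<partial>\<mu>) \<le> ennreal (H * C)"
        by (intro order_trans[OF nn_integral_mono C(2)[OF H(1), of k x]] ennreal_leI)
      then show ?thesis unfolding F
        using nn_integral_cmod_imp_bound[OF _ HC, of "\<lambda>y. f y * K k x y" \<mu>] by simp
    qed
    have F2: "cmod (F k x) \<le> H * C * (\<delta> ^ k) powr s" if "k \<ge> 1" for k x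
    proof -
      have r: "0 < \<delta> ^ k" using constants by simp
      have "(\<integral>\<^sup>+y. ennreal (cmod (K k x y)) \<partial>\<mu>)
          \<le> (\<integral>\<^sup>+y. ennreal (1 * (cmod (K k x y) * (1 + (d x y / \<delta> ^ k) powr s))) \<partial>\<mu>)"
        by (intro nn_integral_mono ennreal_leI) (simp add: algebra_simps)
      also have "\<dots> \<le> ennreal (1 * C)" by (rule C) simp
      finally have "(\<integral>\<^sup>+y. ennreal (cmod (K k x y)) \<partial>\<mu>) \<le> ennreal C" by simp
      then have intK: "integrable \<mu> (K k x)"
        using C by (intro nn_integral_cmod_imp_bound(1)[of _ _ C]) auto
      have "(\<integral>y. (f y - f x) * K k x y \<partial>\<mu>) = F k x - f x * (\<integral>y. K k x y \<partial>\<mu>)"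
        using F1[of k x] intK by (simp add: F left_diff_distrib)
      then have eq: "F k x = (\<integral>y. (f y - f x) * K k x y \<partial>\<mu>)"
        using cancel[OF that] by simp
      \<comment> \<open>Writing d x y powr s as (\<delta> ^ k) powr s times the s-th power of d x y
        / \<delta> ^ k moves the decay into M and leaves the weight of the integral bound.\<close>
      define M where "M = H * (\<delta> ^ k) powr s"
      have M: "0 \<le> M" using H by (simp add: M_def)
      have "cmod ((f y - f x) * K k x y) \<le> M * (cmod (K k x y) * (1 + (d x y / \<delta> ^ k) powr s))" for y
      proof -
        have "cmod (f y - f x) \<le> H * d x y powr s"
          using fH(2)[of x y] by (simp add: norm_minus_commute)
        also have "d x y powr s = (\<delta> ^ k) powr s * (d x y / \<delta> ^ k) powr s"
          using constants by (simp flip: powr_mult)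
        also have "H * ((\<delta> ^ k) powr s * (d x y / \<delta> ^ k) powr s) \<le> M * (1 + (d x y / \<delta> ^ k) powr s)"
          using M by (simp add: M_def algebra_simps)
        finally have "cmod (f y - f x) * cmod (K k x y) \<le> M * (1 + (d x y / \<delta> ^ k) powr s) * cmod (K k x y)"
          by (intro mult_right_mono) auto
        then show ?thesis by (simp add: norm_mult mult_ac)
      qed
      then have "(\<integral>\<^sup>+y. ennreal (cmod ((f y - f x) * K k x y)) \<partial>\<mu>) \<le> ennreal (M * C)"
        by (intro order_trans[OF nn_integral_mono C(2)[OF M, of k x]] ennreal_leI)
      then have "cmod (\<integral>y. (f y - f x) * K k x y \<partial>\<mu>) \<le> M * C"
        using M C by (intro nn_integral_cmod_imp_bound(2)) auto
      then show ?thesis unfolding eq by (simp add: M_def mult_ac)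
    qed
    have low: "(\<integral>\<^sup>+x\<in>Q (int (k + j0)) \<tau>. ennreal (cmod (F k x)) \<partial>\<mu>) / emeasure \<mu> (Q (int (k + j0)) \<tau>)
        \<le> ennreal (H * C)" if "\<tau> \<in> subcubes \<A> Q j0 k \<alpha>" for k \<alpha> \<tau>
    proof -
      let ?E = "Q (int (k + j0)) \<tau>"
      have \<tau>: "\<tau> \<in> \<A> (int (k + j0))" using that by (simp add: subcubes_def)
      have "(\<integral>\<^sup>+x\<in>?E. ennreal (cmod (F k x)) \<partial>\<mu>) \<le> (\<integral>\<^sup>+x\<in>?E. ennreal (H * C) \<partial>\<mu>)"
        using F1 by (intro nn_integral_mono mult_right_mono ennreal_leI) auto
      also have "\<dots> = ennreal (H * C) * emeasure \<mu> ?E"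
        by (rule nn_integral_cmult_indicator[OF cube_measurable[OF \<tau>]])
      finally have "(\<integral>\<^sup>+x\<in>?E. ennreal (cmod (F k x)) \<partial>\<mu>) / emeasure \<mu> ?E
         \<le> ennreal (H * C) * emeasure \<mu> ?E / emeasure \<mu> ?E"
        by (rule divide_right_mono_ennreal)
      also have "\<dots> = ennreal (H * C)"
        using cube_emeasure[OF \<tau>] by (intro mult_divide_eq_ennreal) auto
      finally show ?thesis .
    qed
    have high: "ennreal (\<delta> powr (- (real k * s))) * Linf_norm \<mu> (F k) \<le> ennreal (H * C)" if "N < k" for k
    proof -
      have "Linf_norm \<mu> (F k) \<le> ennreal (H * C * (\<delta> ^ k) powr s)"
        unfolding Linf_norm_def using F2[of k] that by (intro esssup_I) (auto intro!: ennreal_leI)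
      then have "ennreal (\<delta> powr (- (real k * s))) * Linf_norm \<mu> (F k)
          \<le> ennreal (\<delta> powr (- (real k * s))) * ennreal (H * C * (\<delta> ^ k) powr s)"
        by (rule mult_left_mono) simp
      also have "\<dots> = ennreal (H * C)"
        using constants HC
        by (simp add: ennreal_mult'[symmetric] powr_minus powr_powr field_simps flip: powr_realpow)
      finally show ?thesis .
    qed
    have "besov_norm \<mu> \<delta> \<A> Q j0 K N s (fun_distr \<mu> f) \<le> ennreal (H * C) + ennreal (H * C)"
      unfolding besov_norm_def F_def[symmetric]
      by (intro add_mono SUP_least low high) auto
    also have "\<dots> = ennreal (2 * C) * hoelder_norm d \<mu> s f"
      using H C by (simp add: ennreal_plus[symmetric] ennreal_mult'[symmetric] mult_ac del: ennreal_plus)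
    finally show le: "besov_norm \<mu> \<delta> \<A> Q j0 K N s (fun_distr \<mu> f) \<le> ennreal (2 * C) * hoelder_norm d \<mu> s f" .
    also have "\<dots> < \<infinity>" using H by (simp add: ennreal_mult_less_top)
    finally have "besov_norm \<mu> \<delta> \<A> Q j0 K N s (fun_distr \<mu> f) < \<infinity>" .
    then show "fun_distr \<mu> f \<in> besov_space d A0 \<mu> x0 \<delta> \<A> Q j0 \<eta> K N \<beta> \<gamma> s"
      using bounded_fun_distribution[OF bg f fH(1)] by (simp add: besov_space_def)
  qed
qed

end

section \<open>From Besov to Hoelder\<close>

text \<open>The Besov norm contains the nonnegative integral of cmod (h x), the reproducing formula
  the Bochner mean of h. If h is not integrable on E, the latter is 0 by default and the bound still
  holds; thus nothing has to be known about the regularity of \<open>distr_op K f\<close>.\<close>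

lemma cmod_mean_on_le:
  assumes E: "E \<in> sets \<mu>" "emeasure \<mu> E = ennreal (measure \<mu> E)" "0 < measure \<mu> E" and b: "0 \<le> b"
    and le: "(\<integral>\<^sup>+x\<in>E. ennreal (cmod (h x)) \<partial>\<mu>) / emeasure \<mu> E \<le> ennreal b"
  shows "cmod (mean_on \<mu> E h) \<le> b"
proof (cases "set_integrable \<mu> E h")
  case True
  have "ennreal (cmod (LINT x:E|\<mu>. h x)) \<le> (\<integral>\<^sup>+x. ennreal (cmod (indicator E x *\<^sub>R h x)) \<partial>\<mu>)"
    using True integral_norm_bound_ennreal
    unfolding set_integrable_def set_lebesgue_integral_def by blast
  also have "\<dots> = (\<integral>\<^sup>+x\<in>E. ennreal (cmod (h x)) \<partial>\<mu>)"
    by (intro nn_integral_cong) (auto simp: indicator_def)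
  also have "\<dots> = (\<integral>\<^sup>+x\<in>E. ennreal (cmod (h x)) \<partial>\<mu>) / emeasure \<mu> E * emeasure \<mu> E"
    using E by (subst ennreal_divide_times) (simp add: mult_divide_eq_ennreal)
  also have "\<dots> \<le> ennreal b * emeasure \<mu> E" using le by (rule mult_right_mono) simp
  also have "\<dots> = ennreal (b * measure \<mu> E)" using E b by (simp add: ennreal_mult)
  finally have "cmod (LINT x:E|\<mu>. h x) \<le> b * measure \<mu> E"
    using b E by simp
  then show ?thesis
    using E by (simp add: mean_on_def norm_divide pos_divide_le_eq)
next
  case False
  then have "(LINT x:E|\<mu>. h x) = 0"
    by (simp add: set_lebesgue_integral_def set_integrable_def not_integrable_integral_eq)
  then show ?thesis using b by (simp add: mean_on_def)
qed

lemma sample_diff: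
  assumes "E \<in> sets \<mu>" "integrable \<mu> h" "integrable \<mu> h'"
  shows "sample \<mu> k E p h - sample \<mu> k E p h' = sample \<mu> k E p (\<lambda>y. h y - h' y)"
proof -
  have "set_integrable \<mu> E h" "set_integrable \<mu> E h'"
    using assms by (auto intro: integrable_mult_indicator[folded set_integrable_def])
  then show ?thesis by (simp add: sample_def set_integral_diff algebra_simps)
qed

context dyadic_space
begin

lemma sample_measurable:
  assumes K': "case_prod K' \<in> borel_measurable (\<mu> \<Otimes>\<^sub>M \<mu>)" and E: "E \<in> sets \<mu>"
  shows "(\<lambda>x. sample \<mu> k E p (K' x)) \<in> borel_measurable \<mu>"
proof (cases "k = 0")
  case True
  interpret sigma_finite_measure \<mu> by (rule sigma_finite)
  have "(\<lambda>(x, y). indicator E y *\<^sub>R K' x y) \<in> borel_measurable (\<mu> \<Otimes>\<^sub>M \<mu>)"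
    using K' E by measurable
  then have "(\<lambda>x. LINT y:E|\<mu>. K' x y) \<in> borel_measurable \<mu>"
    unfolding set_lebesgue_integral_def by (rule borel_measurable_lebesgue_integral)
  then show ?thesis using True by (simp add: sample_def)
next
  case False
  have [measurable]: "(\<lambda>x. K' x p) \<in> borel_measurable \<mu>"
    by (rule kernel_section_measurable(2)[OF K'])
  show ?thesis using False by (simp add: sample_def)
qed

text \<open>Sampling \<open>K'\<close> over the subcubes costs no more than integrating it, so one scale of
  the reproducing formula inherits the size and the smoothness of \<open>K'\<close>.\<close>

lemma level_sum_bounds:
  assumes g: "0 < \<gamma>" and b: "0 < \<beta>" and c: "0 < c"
  obtains M where "0 < M" "\<And>k K' p coef B.
    case_prod K' \<in> borel_measurable (\<mu> \<Otimes>\<^sub>M \<mu>) \<Longrightarrow>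
    (\<forall>x y. cmod (K' x y) \<le> c * poly_size d \<mu> \<gamma> (\<delta> ^ k) x y) \<Longrightarrow>
    (\<forall>x x' y. d x x' \<le> (\<delta> ^ k + d x y) / (2 * A0) \<longrightarrow>
         cmod (K' x y - K' x' y)
           \<le> c * (d x x' / (\<delta> ^ k + d x y)) powr \<beta> * poly_size d \<mu> \<gamma> (\<delta> ^ k) x y) \<Longrightarrow>
    (\<forall>i\<in>level j0 k. p i \<in> subcube j0 k i) \<Longrightarrow> 0 \<le> B \<Longrightarrow> (\<forall>i\<in>level j0 k. cmod (coef i) \<le> B) \<Longrightarrow>
    let T = (\<lambda>i x. sample \<mu> k (subcube j0 k i) (p i) (K' x) * coef i);
        G = (\<lambda>x. infsum (\<lambda>i. T i x) (level j0 k))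
    in (\<forall>F x. finite F \<longrightarrow> F \<subseteq> level j0 k \<longrightarrow> (\<Sum>i\<in>F. cmod (T i x)) \<le> M * B) \<and>
       (\<forall>x. cmod (G x) \<le> M * B) \<and>
       (\<forall>x x'. cmod (G x - G x') \<le> M * B) \<and>
       (\<forall>x x'. cmod (G x - G x') \<le> M * B * (d x x' / \<delta> ^ k) powr \<beta>)"
proof (rule sum_sample_le[OF g, where ?j0.0 = j0])
  fix C assume C: "0 < C" "\<And>k M x h p F. 0 \<le> M \<Longrightarrow> h \<in> borel_measurable \<mu> \<Longrightarrow>
     \<forall>y. cmod (h y) \<le> M * poly_size d \<mu> \<gamma> (\<delta> ^ k) x y \<Longrightarrow>
     finite F \<Longrightarrow> F \<subseteq> level j0 k \<Longrightarrow> \<forall>i\<in>F. p i \<in> subcube j0 k i \<Longrightarrow>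
     (\<Sum>i\<in>F. cmod (sample \<mu> k (subcube j0 k i) (p i) h)) \<le> M * C"
  \<comment> \<open>c * C is the size of one sum, 2 covers a difference of two, and (2 * A0) powr
    \<beta> pays for pairs too far apart for the regularity of the kernel.\<close>
  define M where "M = 2 * (2 * A0) powr \<beta> * c * C"
  have A: "1 \<le> (2 * A0) powr \<beta>" using A0_ge_1 b by (intro ge_one_powr_ge_zero) auto
  have cC: "0 < c * C" using c C by simp
  have M: "2 * c * C \<le> M" using A cC mult_right_mono[of 1 "(2 * A0) powr \<beta>" "2 * c * C"]
    by (simp add: M_def mult_ac)
  show ?thesis
  proof (rule that)
    show "0 < M" using M cC by simp
    fix k K' p coef B
    assume jm: "case_prod K' \<in> borel_measurable (\<mu> \<Otimes>\<^sub>M \<mu>)"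
      and size: "\<forall>x y. cmod (K' x y) \<le> c * poly_size d \<mu> \<gamma> (\<delta> ^ k) x y"
      and reg: "\<forall>x x' y. d x x' \<le> (\<delta> ^ k + d x y) / (2 * A0) \<longrightarrow>
         cmod (K' x y - K' x' y)
           \<le> c * (d x x' / (\<delta> ^ k + d x y)) powr \<beta> * poly_size d \<mu> \<gamma> (\<delta> ^ k) x y"
      and p: "\<forall>i\<in>level j0 k. p i \<in> subcube j0 k i"
      and B: "0 \<le> (B::real)" and coef: "\<forall>i\<in>level j0 k. cmod (coef i) \<le> B"
    note Km [measurable] = kernel_section_measurable(1)[OF jm]
    have r: "0 < \<delta> ^ k" using constants by simp
    define S where "S i h = sample \<mu> k (subcube j0 k i) (p i) h" for i h
    define T where "T i x = S i (K' x) * coef i" for i x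
    define G where "G x = infsum (\<lambda>i. T i x) (level j0 k)" for x
    \<comment> \<open>Stated for a general h, because it is applied both to K' x and to differences
      K' x - K' x'.\<close>
    have sum_coef: "(\<Sum>i\<in>F. cmod (S i h * coef i)) \<le> m * C * B"
      if F: "finite F" "F \<subseteq> level j0 k" and m: "0 \<le> m" and h: "h \<in> borel_measurable \<mu>"
        "\<forall>y. cmod (h y) \<le> m * poly_size d \<mu> \<gamma> (\<delta> ^ k) x y" for F m h x
    proof -
      have "(\<Sum>i\<in>F. cmod (S i h * coef i)) \<le> (\<Sum>i\<in>F. cmod (S i h) * B)"
        using coef F by (intro sum_mono) (auto simp: norm_mult intro!: mult_left_mono)
      also have "\<dots> = (\<Sum>i\<in>F. cmod (S i h)) * B" by (rule sum_distrib_right[symmetric])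
      also have "\<dots> \<le> m * C * B"
        unfolding S_def using F p by (intro mult_right_mono C(2)[OF m h] B) auto
      finally show ?thesis .
    qed
    have T1: "(\<Sum>i\<in>F. cmod (T i x)) \<le> c * C * B" if "finite F" "F \<subseteq> level j0 k" for F x
      unfolding T_def using that c size by (intro sum_coef) auto
    have Tsum: "(\<lambda>i. T i x) summable_on level j0 k" for x
      by (rule infsum_bounded[of _ _ "c * C * B"]) (rule T1)
    have G1: "cmod (G x) \<le> c * C * B" for x
      unfolding G_def by (rule infsum_bounded) (rule T1)
    have G2: "cmod (G x - G x') \<le> 2 * c * C * B" for x x'
      using norm_triangle_ineq4[of "G x" "G x'"] G1[of x] G1[of x'] by simp
    have "2 * c * C * B \<le> M * B" using M B by (rule mult_right_mono)
    moreover have "0 \<le> c * C * B" using cC B by simp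
    ultimately have MB: "c * C * B \<le> M * B" "2 * c * C * B \<le> M * B" "0 \<le> M * B" by linarith+
    have intK: "integrable \<mu> (K' x)" for x
      using g r Km less_imp_le[OF c] size[rule_format] by (rule integrable_poly_bound)
    have G3: "cmod (G x - G x') \<le> M * B * (d x x' / \<delta> ^ k) powr \<beta>" for x x'
    proof (cases "d x x' \<le> \<delta> ^ k / (2 * A0)")
      case True
      define u where "u = (d x x' / \<delta> ^ k) powr \<beta>"
      have u: "0 \<le> u" by (simp add: u_def)
      \<comment> \<open>This closeness lies in the regularity range for every y at once, and
        \<delta> ^ k + d x y \<ge> \<delta> ^ k frees the smoothness factor of y. The difference is
        then a kernel of the same size with constant c * u.\<close>
      have near: "cmod (K' x y - K' x' y) \<le> (c * u) * poly_size d \<mu> \<gamma> (\<delta> ^ k) x y" for y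
      proof -
        have "\<delta> ^ k / (2 * A0) \<le> (\<delta> ^ k + d x y) / (2 * A0)"
          using A0_ge_1 by (intro divide_right_mono) auto
        then have "cmod (K' x y - K' x' y)
           \<le> c * (d x x' / (\<delta> ^ k + d x y)) powr \<beta> * poly_size d \<mu> \<gamma> (\<delta> ^ k) x y"
          using True reg by (meson order_trans)
        also have "\<dots> \<le> c * u * poly_size d \<mu> \<gamma> (\<delta> ^ k) x y"
        proof -
          have "d x x' / (\<delta> ^ k + d x y) \<le> d x x' / \<delta> ^ k"
            using r by (intro divide_left_mono mult_pos_pos add_pos_nonneg) auto
          then have "(d x x' / (\<delta> ^ k + d x y)) powr \<beta> \<le> u"
            unfolding u_def using b r by (intro powr_mono2) auto
          then show ?thesis using c by (intro mult_right_mono mult_left_mono) auto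
        qed
        finally show ?thesis .
      qed
      have "G x - G x' = infsum (\<lambda>i. T i x - T i x') (level j0 k)"
        using infsum_add[OF Tsum[of x], of "\<lambda>i. - T i x'"] Tsum[of x']
        by (simp add: G_def summable_on_uminus infsum_uminus)
      also have "cmod \<dots> \<le> c * u * C * B"
      proof (rule infsum_bounded(2))
        fix F assume F: "finite F" "F \<subseteq> level j0 k"
        have "T i x - T i x' = S i (\<lambda>y. K' x y - K' x' y) * coef i" if "i \<in> F" for i
        proof -
          have "i \<in> level j0 k" using that F by blast
          then show ?thesis
            using sample_diff[OF subcube_measurable intK intK, of i j0 k k "p i" x x']
            by (simp add: T_def S_def left_diff_distrib[symmetric])
        qed
        then have "(\<Sum>i\<in>F. cmod (T i x - T i x')) = (\<Sum>i\<in>F. cmod (S i (\<lambda>y. K' x y - K' x' y) * coef i))"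
          by (intro sum.cong) auto
        also have "\<dots> \<le> c * u * C * B"
          using F c u near by (intro sum_coef) auto
        finally show "(\<Sum>i\<in>F. cmod (T i x - T i x')) \<le> c * u * C * B" .
      qed
      also have "\<dots> = (c * C * B) * u" by simp
      also have "\<dots> \<le> M * B * u" by (rule mult_right_mono[OF MB(1) u])
      finally show ?thesis by (simp add: u_def)
    next
      case False
      \<comment> \<open>For distant points the factor on the right is bounded below, so the bound on
        the sizes suffices.\<close>
      then have "1 \<le> 2 * A0 * (d x x' / \<delta> ^ k)"
        using r A0_ge_1 by (simp add: field_simps)
      then have "1 \<le> (2 * A0 * (d x x' / \<delta> ^ k)) powr \<beta>"
        using b by (intro ge_one_powr_ge_zero) auto
      also have "\<dots> = (2 * A0) powr \<beta> * (d x x' / \<delta> ^ k) powr \<beta>"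
        by (rule powr_mult)
      finally have "2 * c * C * B * 1 \<le> 2 * c * C * B * ((2 * A0) powr \<beta> * (d x x' / \<delta> ^ k) powr \<beta>)"
        using less_imp_le[OF c] less_imp_le[OF C(1)] B by (intro mult_left_mono) simp_all
      then show ?thesis using G2[of x x'] by (simp add: M_def mult_ac)
    qed
    show "let T = (\<lambda>i x. sample \<mu> k (subcube j0 k i) (p i) (K' x) * coef i);
        G = (\<lambda>x. infsum (\<lambda>i. T i x) (level j0 k))
    in (\<forall>F x. finite F \<longrightarrow> F \<subseteq> level j0 k \<longrightarrow> (\<Sum>i\<in>F. cmod (T i x)) \<le> M * B) \<and>
       (\<forall>x. cmod (G x) \<le> M * B) \<and>
       (\<forall>x x'. cmod (G x - G x') \<le> M * B) \<and>
       (\<forall>x x'. cmod (G x - G x') \<le> M * B * (d x x' / \<delta> ^ k) powr \<beta>)"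
      unfolding Let_def S_def[symmetric] T_def[symmetric] G_def[symmetric]
      using G3 order_trans[OF T1 MB(1)] order_trans[OF G1 MB(1)] order_trans[OF G2 MB(2)] by blast
  qed
qed

text \<open>The essential supremum controls only almost every point, so the sample points are chosen,
  depending on \<open>f\<close>, outside the exceptional null sets. This is harmless because the constant
  in the reproducing formula is uniform in the sample points.\<close>

lemma besov_coefficients:
  assumes f: "besov_norm \<mu> \<delta> \<A> Q j0 K N s f = ennreal b" "0 \<le> b" and s: "0 < s"
  obtains p where "\<And>k \<alpha> \<tau>. \<tau> \<in> subcubes \<A> Q j0 k \<alpha> \<Longrightarrow> p k \<alpha> \<tau> \<in> Q (int (k + j0)) \<tau>"
    "\<And>k \<alpha> \<tau>. \<alpha> \<in> \<A> (int k) \<Longrightarrow> \<tau> \<in> subcubes \<A> Q j0 k \<alpha> \<Longrightarrow> k \<le> N \<Longrightarrow>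
       cmod (mean_on \<mu> (Q (int (k + j0)) \<tau>) (distr_op (K k) f)) \<le> b"
    "\<And>k \<alpha> \<tau>. \<tau> \<in> subcubes \<A> Q j0 k \<alpha> \<Longrightarrow> N < k \<Longrightarrow>
       cmod (distr_op (K k) f (p k \<alpha> \<tau>)) \<le> b * (\<delta> powr s) ^ k"
proof -
  let ?E = "\<lambda>k \<tau>. Q (int (k + j0)) \<tau>"
  have sub: "\<tau> \<in> \<A> (int (k + j0))" if "\<tau> \<in> subcubes \<A> Q j0 k \<alpha>" for k \<alpha> \<tau>
    using that by (simp add: subcubes_def)
  have low: "(\<integral>\<^sup>+x\<in>?E k \<tau>. ennreal (cmod (distr_op (K k) f x)) \<partial>\<mu>) / emeasure \<mu> (?E k \<tau>) \<le> ennreal b"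
    if "k \<le> N" "\<alpha> \<in> \<A> (int k)" "\<tau> \<in> subcubes \<A> Q j0 k \<alpha>" for k \<alpha> \<tau>
  proof -
    have "(SUP k\<in>{0..N}. SUP \<alpha>\<in>\<A> (int k). SUP \<tau>\<in>subcubes \<A> Q j0 k \<alpha>.
        (\<integral>\<^sup>+x\<in>?E k \<tau>. ennreal (cmod (distr_op (K k) f x)) \<partial>\<mu>) / emeasure \<mu> (?E k \<tau>)) \<le> ennreal b"
      unfolding f(1)[symmetric] besov_norm_def by simp
    then show ?thesis using that unfolding SUP_le_iff by auto
  qed
  have mean: "cmod (mean_on \<mu> (?E k \<tau>) (distr_op (K k) f)) \<le> b"
    if "\<alpha> \<in> \<A> (int k)" "\<tau> \<in> subcubes \<A> Q j0 k \<alpha>" "k \<le> N" for k \<alpha> \<tau>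
    using cube_measurable[OF sub] cube_emeasure[OF sub] that
    by (intro cmod_mean_on_le[OF _ _ _ f(2) low]) auto
  have high: "\<exists>y\<in>?E k \<tau>. cmod (distr_op (K k) f y) \<le> b * (\<delta> powr s) ^ k"
    if \<tau>: "\<tau> \<in> subcubes \<A> Q j0 k \<alpha>" and k: "N < k" for k \<alpha> \<tau>
  proof (rule AE_imp_ex_in_set)
    let ?L = "Linf_norm \<mu> (distr_op (K k) f)"
    have "(SUP k\<in>{N<..}. ennreal (\<delta> powr (- (real k * s))) * Linf_norm \<mu> (distr_op (K k) f)) \<le> ennreal b"
      unfolding f(1)[symmetric] besov_norm_def by simp
    then have "ennreal (\<delta> powr (- (real k * s))) * ?L \<le> ennreal b"
      using k unfolding SUP_le_iff by auto
    then have "ennreal ((\<delta> powr s) ^ k) * (ennreal (\<delta> powr (- (real k * s))) * ?L)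
        \<le> ennreal ((\<delta> powr s) ^ k) * ennreal b"
      by (rule mult_left_mono) simp
    moreover have "ennreal ((\<delta> powr s) ^ k) * ennreal (\<delta> powr (- (real k * s))) = 1"
      using constants by (simp add: ennreal_mult'[symmetric] powr_powr powr_minus mult.commute
        flip: powr_realpow)
    then have "ennreal ((\<delta> powr s) ^ k) * (ennreal (\<delta> powr (- (real k * s))) * ?L) = ?L"
      by (metis mult.assoc mult_1)
    moreover have "ennreal ((\<delta> powr s) ^ k) * ennreal b = ennreal (b * (\<delta> powr s) ^ k)"
      using f(2) by (subst ennreal_mult[symmetric]) (auto simp: mult.commute)
    ultimately have L: "?L \<le> ennreal (b * (\<delta> powr s) ^ k)"
      by simp
    have "AE y in \<mu>. ennreal (cmod (distr_op (K k) f y)) \<le> ?L"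
      unfolding Linf_norm_def by (rule esssup_AE)
    then show "AE y in \<mu>. cmod (distr_op (K k) f y) \<le> b * (\<delta> powr s) ^ k"
    proof (rule eventually_mono)
      fix y assume "ennreal (cmod (distr_op (K k) f y)) \<le> ?L"
      then have "ennreal (cmod (distr_op (K k) f y)) \<le> ennreal (b * (\<delta> powr s) ^ k)"
        using L by (rule order_trans)
      then show "cmod (distr_op (K k) f y) \<le> b * (\<delta> powr s) ^ k"
        using f(2) by simp
    qed
    show "?E k \<tau> \<in> sets \<mu>" by (rule cube_measurable[OF sub[OF \<tau>]])
    show "0 < emeasure \<mu> (?E k \<tau>)" using cube_emeasure[OF sub[OF \<tau>]] by simp
  qed
  \<comment> \<open>For k \<le> N the coefficient is a mean, so any point of the nonempty cube may
    serve as the sample point.\<close>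
  have "\<exists>y. y \<in> ?E k \<tau> \<and> (N < k \<longrightarrow> cmod (distr_op (K k) f y) \<le> b * (\<delta> powr s) ^ k)"
    if "\<tau> \<in> subcubes \<A> Q j0 k \<alpha>" for k \<alpha> \<tau>
    using high[OF that] cube_nonempty[OF sub[OF that]] by blast
  note pick = someI_ex[OF this]
  show ?thesis
    by (rule that[of "\<lambda>k \<alpha> \<tau>. SOME y. y \<in> ?E k \<tau> \<and>
          (N < k \<longrightarrow> cmod (distr_op (K k) f y) \<le> b * (\<delta> powr s) ^ k)"])
      (use pick mean in blast)+
qed

text \<open>The order of choices matters: c, C2 and M0 are fixed first, then f, its sample points p
  and the kernels K' belonging to p. The function g is the sum of the scales and is defined before
  any test function enters.\<close>

theorem besov_imp_hoelder:
  assumes repr: "reproducing_formula d A0 \<mu> x0 \<delta> \<A> Q j0 \<eta> K N"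
    and bg: "0 < \<beta>" "\<beta> < \<eta>" "0 < \<gamma>" "\<gamma> < \<eta>" and s: "0 < s" "s < \<beta>"
  shows "\<exists>C::real. 0 < C \<and> (\<forall>f\<in>besov_space d A0 \<mu> x0 \<delta> \<A> Q j0 \<eta> K N \<beta> \<gamma> s.
            \<exists>g\<in>hoelder_space d \<mu> s.
              (\<forall>\<phi>\<in>test_space0 d A0 \<mu> x0 \<eta> \<beta> \<gamma>. f \<phi> = fun_distr \<mu> g \<phi>) \<and>
              hoelder_norm d \<mu> s g \<le> ennreal C * besov_norm \<mu> \<delta> \<A> Q j0 K N s f)"
proof -
  define q where "q = \<delta> powr s"
  have q: "0 < q" "q < 1"
    using constants s powr01_less_one[of \<delta> s] by (auto simp: q_def)
  have geo: "summable (\<lambda>k. q ^ k)" "(\<Sum>k. q ^ k) = 1 / (1 - q)"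
    using q by (auto simp: summable_geometric suminf_geometric)
  obtain c where c: "0 < c" and c_repr: "\<forall>p. (\<forall>k. \<forall>\<alpha>\<in>\<A> (int k). \<forall>\<tau>\<in>subcubes \<A> Q j0 k \<alpha>. p k \<alpha> \<tau> \<in> Q (int (k + j0)) \<tau>) \<longrightarrow>
    (\<exists>K'.
      (\<forall>k. bounded_L2_kernel \<mu> (K' k)) \<and>
      (\<forall>k x y. cmod (K' k x y) \<le> c * poly_size d \<mu> \<gamma> (\<delta> ^ k) x y) \<and>
      (\<forall>k x x' y. d x x' \<le> (\<delta> ^ k + d x y) / (2 * A0) \<longrightarrow>
         cmod (K' k x y - K' k x' y)
           \<le> c * (d x x' / (\<delta> ^ k + d x y)) powr \<beta> * poly_size d \<mu> \<gamma> (\<delta> ^ k) x y) \<and>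
      (\<forall>k x. (\<integral>y. K' k x y \<partial>\<mu>) = (if k \<le> N then 1 else 0) \<and>
             (\<integral>y. K' k y x \<partial>\<mu>) = (if k \<le> N then 1 else 0)) \<and>
      (\<forall>f\<in>distributions d A0 \<mu> x0 \<eta> \<beta> \<gamma>. \<forall>\<phi>\<in>test_space0 d A0 \<mu> x0 \<eta> \<beta> \<gamma>.
         let I = (\<lambda>k. SIGMA \<alpha>:\<A> (int k). subcubes \<A> Q j0 k \<alpha>);
             t = (\<lambda>k (\<alpha>, \<tau>). fun_distr \<mu>
                    (repr_term \<mu> N k (K k) (K' k) (Q (int (k + j0)) \<tau>) (p k \<alpha> \<tau>) f) \<phi>)
         in (\<forall>k. t k summable_on I k) \<and> (\<lambda>k. infsum (t k) (I k)) sums f \<phi>))"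
  proof -
    have "\<beta> \<in> {0<..<\<eta>}" "\<gamma> \<in> {0<..<\<eta>}" using bg by auto
    from bspec[OF bspec[OF repr[unfolded reproducing_formula_def] this(1)] this(2)]
    show ?thesis by (elim exE conjE) (rule that)
  qed
  obtain C2 where C2: "0 < C2" "\<And>M t (u :: nat \<Rightarrow> real). 0 \<le> M \<Longrightarrow> 0 < t \<Longrightarrow> (\<forall>k. 0 \<le> u k) \<Longrightarrow>
     (\<forall>k. u k \<le> M * (\<delta> powr s) ^ k) \<Longrightarrow> (\<forall>k. u k \<le> M * (\<delta> powr s) ^ k * (t / \<delta> ^ k) powr \<beta>) \<Longrightarrow>
     suminf u \<le> M * C2 * t powr s"
    using two_scale_series[OF constants(3,4) s] by blast
  show ?thesis
  proof (rule level_sum_bounds[OF bg(3,1) c, where ?j0.0 = j0])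
    fix M0
    assume M0: "0 < M0" and level: "\<And>k K' p coef B.
      case_prod K' \<in> borel_measurable (\<mu> \<Otimes>\<^sub>M \<mu>) \<Longrightarrow>
      (\<forall>x y. cmod (K' x y) \<le> c * poly_size d \<mu> \<gamma> (\<delta> ^ k) x y) \<Longrightarrow>
      (\<forall>x x' y. d x x' \<le> (\<delta> ^ k + d x y) / (2 * A0) \<longrightarrow>
           cmod (K' x y - K' x' y)
             \<le> c * (d x x' / (\<delta> ^ k + d x y)) powr \<beta> * poly_size d \<mu> \<gamma> (\<delta> ^ k) x y) \<Longrightarrow>
      (\<forall>i\<in>level j0 k. p i \<in> subcube j0 k i) \<Longrightarrow> 0 \<le> B \<Longrightarrow> (\<forall>i\<in>level j0 k. cmod (coef i) \<le> B) \<Longrightarrow>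
      let T = (\<lambda>i x. sample \<mu> k (subcube j0 k i) (p i) (K' x) * coef i);
          G = (\<lambda>x. infsum (\<lambda>i. T i x) (level j0 k))
      in (\<forall>F x. finite F \<longrightarrow> F \<subseteq> level j0 k \<longrightarrow> (\<Sum>i\<in>F. cmod (T i x)) \<le> M0 * B) \<and>
         (\<forall>x. cmod (G x) \<le> M0 * B) \<and>
         (\<forall>x x'. cmod (G x - G x') \<le> M0 * B) \<and>
         (\<forall>x x'. cmod (G x - G x') \<le> M0 * B * (d x x' / \<delta> ^ k) powr \<beta>)"
    \<comment> \<open>The division by q ^ N compensates for the missing decay of the coefficients
      with k \<le> N.\<close>
    define M1 where "M1 = M0 / q ^ N"
    have M1: "0 < M1" using M0 q by (simp add: M1_def)
    \<comment> \<open>C2 comes from the Hoelder quotient of g, 1 / (1 - q) from its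
      supremum.\<close>
    define C where "C = M1 * (C2 + 1 / (1 - q))"
    show ?thesis
    proof (intro exI conjI ballI)
      show "0 < C" using M1 C2 q by (simp add: C_def add_pos_pos)
      fix f assume f: "f \<in> besov_space d A0 \<mu> x0 \<delta> \<A> Q j0 \<eta> K N \<beta> \<gamma> s"
      then have fd: "f \<in> distributions d A0 \<mu> x0 \<eta> \<beta> \<gamma>"
        and fin: "besov_norm \<mu> \<delta> \<A> Q j0 K N s f < \<infinity>" by (auto simp: besov_space_def)
      obtain b where b: "0 \<le> b" "besov_norm \<mu> \<delta> \<A> Q j0 K N s f = ennreal b"
        using fin by (cases "besov_norm \<mu> \<delta> \<A> Q j0 K N s f") auto
      obtain p where p: "\<And>k \<alpha> \<tau>. \<tau> \<in> subcubes \<A> Q j0 k \<alpha> \<Longrightarrow> p k \<alpha> \<tau> \<in> Q (int (k + j0)) \<tau>"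
        and coef_low: "\<And>k \<alpha> \<tau>. \<alpha> \<in> \<A> (int k) \<Longrightarrow> \<tau> \<in> subcubes \<A> Q j0 k \<alpha> \<Longrightarrow> k \<le> N \<Longrightarrow>
           cmod (mean_on \<mu> (Q (int (k + j0)) \<tau>) (distr_op (K k) f)) \<le> b"
        and coef_high: "\<And>k \<alpha> \<tau>. \<tau> \<in> subcubes \<A> Q j0 k \<alpha> \<Longrightarrow> N < k \<Longrightarrow>
           cmod (distr_op (K k) f (p k \<alpha> \<tau>)) \<le> b * (\<delta> powr s) ^ k"
        using besov_coefficients[OF b(2,1) s(1)] by blast
      have "\<forall>k. \<forall>\<alpha>\<in>\<A> (int k). \<forall>\<tau>\<in>subcubes \<A> Q j0 k \<alpha>. p k \<alpha> \<tau> \<in> Q (int (k + j0)) \<tau>"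
        using p by blast
      from mp[OF spec[OF c_repr] this]
      obtain K' where K': "\<forall>k. bounded_L2_kernel \<mu> (K' k)"
        and size: "\<forall>k x y. cmod (K' k x y) \<le> c * poly_size d \<mu> \<gamma> (\<delta> ^ k) x y"
        and reg: "\<forall>k x x' y. d x x' \<le> (\<delta> ^ k + d x y) / (2 * A0) \<longrightarrow>
           cmod (K' k x y - K' k x' y)
             \<le> c * (d x x' / (\<delta> ^ k + d x y)) powr \<beta> * poly_size d \<mu> \<gamma> (\<delta> ^ k) x y"
        and form: "\<forall>f\<in>distributions d A0 \<mu> x0 \<eta> \<beta> \<gamma>. \<forall>\<phi>\<in>test_space0 d A0 \<mu> x0 \<eta> \<beta> \<gamma>.
         let I = (\<lambda>k. SIGMA \<alpha>:\<A> (int k). subcubes \<A> Q j0 k \<alpha>);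
             t = (\<lambda>k (\<alpha>, \<tau>). fun_distr \<mu>
                    (repr_term \<mu> N k (K k) (K' k) (Q (int (k + j0)) \<tau>) (p k \<alpha> \<tau>) f) \<phi>)
         in (\<forall>k. t k summable_on I k) \<and> (\<lambda>k. infsum (t k) (I k)) sums f \<phi>"
        by (elim exE conjE) (rule that)
      have jm: "case_prod (K' k) \<in> borel_measurable (\<mu> \<Otimes>\<^sub>M \<mu>)" for k
        using K' by (simp add: bounded_L2_kernel_def)
      define P where "P k i = p k (fst i) (snd i)" for k i
      define coef where "coef k i = (if k \<le> N then mean_on \<mu> (subcube j0 k i) (distr_op (K k) f)
        else distr_op (K k) f (P k i))" for k i
      have P: "\<forall>i\<in>level j0 k. P k i \<in> subcube j0 k i" for k
        using p by (auto simp: P_def level_def subcube_def)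
      \<comment> \<open>A common majorant: for k \<le> N the factor q ^ k / q ^ N is at least 1, and
        for k > N dividing by q ^ N \<le> 1 only enlarges b * q ^ k.\<close>
      define B where "B k = b / q ^ N * q ^ k" for k
      have B: "0 \<le> B k" for k using b q by (simp add: B_def)
      have coef_le: "\<forall>i\<in>level j0 k. cmod (coef k i) \<le> B k" for k
      proof
        fix i assume i: "i \<in> level j0 k"
        show "cmod (coef k i) \<le> B k"
        proof (cases "k \<le> N")
          case True
          have "cmod (coef k i) \<le> b"
            using coef_low[of "fst i" k "snd i"] i True by (auto simp: coef_def level_def subcube_def)
          also have "b * 1 \<le> b * (q ^ k / q ^ N)"
            using q b True by (intro mult_left_mono) (auto simp: power_decreasing)
          finally show ?thesis by (simp add: B_def)
        next
          case False
          then have "cmod (coef k i) \<le> b * q ^ k"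
            using coef_high[of "snd i" k "fst i"] i by (auto simp: coef_def level_def P_def q_def)
          also have "\<dots> \<le> b / q ^ N * q ^ k"
            using q b by (intro mult_right_mono) (auto simp: field_simps power_le_one mult_left_le)
          finally show ?thesis by (simp add: B_def)
        qed
      qed
      define T where "T k i x = sample \<mu> k (subcube j0 k i) (P k i) (K' k x) * coef k i" for k i x
      define G where "G k x = infsum (\<lambda>i. T k i x) (level j0 k)" for k x
      define M where "M = M1 * b"
      have M: "0 \<le> M" using M1 b by (simp add: M_def)
      have MB: "M0 * B k = M * q ^ k" for k by (simp add: M_def M1_def B_def)
      note lev = level[OF jm spec[OF size] spec[OF reg] P B coef_le, unfolded Let_def, folded T_def, folded G_def, unfolded MB]
      have T1: "(\<Sum>i\<in>F. cmod (T k i x)) \<le> M * q ^ k" if "finite F" "F \<subseteq> level j0 k" for F k x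
        using lev[of k] that by blast
      have G1: "cmod (G k x) \<le> M * q ^ k" for k x using lev[of k] by blast
      have G2: "cmod (G k x - G k x') \<le> M * q ^ k" for k x x' using lev[of k] by blast
      have G3: "cmod (G k x - G k x') \<le> M * q ^ k * (d x x' / \<delta> ^ k) powr \<beta>" for k x x'
        using lev[of k] by blast
      have geoM: "summable (\<lambda>k. M * q ^ k)" using geo by (intro summable_mult)
      have nG: "summable (\<lambda>k. cmod (G k x))" for x
        by (rule summable_comparison_test'[OF geoM, of 0]) (use G1 in auto)
      have sG: "summable (\<lambda>k. G k x)" for x by (rule summable_norm_cancel[OF nG])
      define g where "g x = (\<Sum>k. G k x)" for x
      have g1: "cmod (g x) \<le> M * (1 / (1 - q))" for x
      proof -
        have "cmod (g x) \<le> (\<Sum>k. cmod (G k x))" unfolding g_def by (rule summable_norm[OF nG])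
        also have "\<dots> \<le> (\<Sum>k. M * q ^ k)" using G1 nG geoM by (intro suminf_le)
        also have "\<dots> = M * (1 / (1 - q))" using geo by (simp add: suminf_mult)
        finally show ?thesis .
      qed
      have g2: "cmod (g x - g y) \<le> M * C2 * d x y powr s" for x y
      proof (cases "x = y")
        case False
        have nd: "summable (\<lambda>k. cmod (G k x - G k y))"
          by (rule summable_comparison_test'[OF geoM, of 0]) (use G2 in auto)
        have "g x - g y = (\<Sum>k. G k x - G k y)"
          unfolding g_def by (rule suminf_diff[OF sG sG])
        also have "cmod \<dots> \<le> (\<Sum>k. cmod (G k x - G k y))"
          by (rule summable_norm[OF nd])
        also have "\<dots> \<le> M * C2 * d x y powr s"
          \<comment> \<open>The two-scale bound with t = d x y: G2 supplies its size hypothesis and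
            G3 its smoothness hypothesis.\<close>
          using M d_pos[OF False] G2 G3 by (intro C2(2)) (auto simp: q_def[symmetric])
        finally show ?thesis .
      qed (use M C2(1) in simp)
      have bounds: "0 \<le> M * (1 / (1 - q))" "0 \<le> M * C2" using M q C2 by auto
      note g = hoelder_spaceI[OF s(1) bounds g1 g2]
      have "f \<phi> = fun_distr \<mu> g \<phi>" if \<phi>: "\<phi> \<in> test_space0 d A0 \<mu> x0 \<eta> \<beta> \<gamma>" for \<phi>
      proof -
        have int\<phi>: "integrable \<mu> \<phi>"
          using test_space_integrable[OF bg(1,3)] \<phi> unfolding test_space0_def by blast
        let ?t = "\<lambda>k (\<alpha>, \<tau>). fun_distr \<mu>
                    (repr_term \<mu> N k (K k) (K' k) (Q (int (k + j0)) \<tau>) (p k \<alpha> \<tau>) f) \<phi>"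
        \<comment> \<open>In terms of \<open>sample\<close> and \<open>coef\<close> the three cases
          of \<open>repr_term\<close> become a single product.\<close>
        have t: "?t k = (\<lambda>i. \<integral>x. T k i x * \<phi> x \<partial>\<mu>)" for k
          by (auto simp: fun_eq_iff fun_distr_def repr_term_eq T_def coef_def P_def subcube_def
              intro!: Bochner_Integration.integral_cong)
        have "(\<forall>k. ?t k summable_on level j0 k) \<and> (\<lambda>k. infsum (?t k) (level j0 k)) sums f \<phi>"
          using form[rule_format, OF fd \<phi>] unfolding Let_def level_def .
        then have sm: "(\<lambda>i. \<integral>x. T k i x * \<phi> x \<partial>\<mu>) summable_on level j0 k"
          and sums: "(\<lambda>k. infsum (\<lambda>i. \<integral>x. T k i x * \<phi> x \<partial>\<mu>) (level j0 k)) sums f \<phi>" for k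
          unfolding t by auto
        have Tm: "T k i \<in> borel_measurable \<mu>" if "i \<in> level j0 k" for k i
          unfolding T_def[abs_def] using sample_measurable[OF jm subcube_measurable[OF that]] by measurable
        \<comment> \<open>Within one scale the sum over cubes is exchanged with the integral against
          \<phi>, the partial sums being dominated by M * q ^ k times cmod (\<phi> x).\<close>
        have swap: "infsum (\<lambda>i. \<integral>x. T k i x * \<phi> x \<partial>\<mu>) (level j0 k) = (\<integral>x. G k x * \<phi> x \<partial>\<mu>)"
          "(\<lambda>x. G k x) \<in> borel_measurable \<mu>" for k
          unfolding G_def by (rule infsum_integral_mult[OF countable_level Tm T1 int\<phi> sm]; assumption)+
        have intG: "integrable \<mu> (\<lambda>x. G k x * \<phi> x)" for k
          using int\<phi> swap(2) G1 by (rule integrable_bounded_mult)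
        have "(\<lambda>k. \<integral>x. G k x * \<phi> x \<partial>\<mu>) sums (\<integral>x. (\<Sum>k. G k x * \<phi> x) \<partial>\<mu>)"
        \<comment> \<open>The sum over the scales is exchanged next; the integrals of the absolute
          values are summable because q < 1.\<close>
        proof (rule sums_integral[OF intG])
          show "AE x in \<mu>. summable (\<lambda>k. cmod (G k x * \<phi> x))"
            using nG by (simp add: norm_mult summable_mult2)
          have "(\<integral>x. cmod (G k x * \<phi> x) \<partial>\<mu>) \<le> M * q ^ k * (\<integral>x. cmod (\<phi> x) \<partial>\<mu>)" for k
          proof -
            have "(\<integral>x. cmod (G k x * \<phi> x) \<partial>\<mu>) \<le> (\<integral>x. M * q ^ k * cmod (\<phi> x) \<partial>\<mu>)"
              using intG int\<phi> G1
              by (intro integral_mono integrable_norm) (auto simp: norm_mult mult_right_mono)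
            then show ?thesis by simp
          qed
          then show "summable (\<lambda>k. \<integral>x. cmod (G k x * \<phi> x) \<partial>\<mu>)"
            by (intro summable_comparison_test'[OF summable_mult2[OF geoM], of 0]) auto
        qed
        moreover have "(\<Sum>k. G k x * \<phi> x) = g x * \<phi> x" for x
          unfolding g_def by (rule suminf_mult2[OF sG, symmetric])
        ultimately have "(\<lambda>k. \<integral>x. G k x * \<phi> x \<partial>\<mu>) sums fun_distr \<mu> g \<phi>"
          by (simp add: fun_distr_def)
        then show ?thesis using sums unfolding swap(1) by (rule sums_unique2[symmetric])
      qed
      moreover have "ennreal (M * C2 + M * (1 / (1 - q))) = ennreal C * besov_norm \<mu> \<delta> \<A> Q j0 K N s f"
        using \<open>0 < C\<close> b by (simp add: ennreal_mult'[symmetric] C_def M_def algebra_simps)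
      ultimately show "\<exists>g\<in>hoelder_space d \<mu> s.
              (\<forall>\<phi>\<in>test_space0 d A0 \<mu> x0 \<eta> \<beta> \<gamma>. f \<phi> = fun_distr \<mu> g \<phi>) \<and>
              hoelder_norm d \<mu> s g \<le> ennreal C * besov_norm \<mu> \<delta> \<A> Q j0 K N s f"
        using g by (intro bexI[of _ g]) auto
    qed
  qed
qed

end

theorem theorem6p15:
  fixes d :: "'a \<Rightarrow> 'a \<Rightarrow> real" and \<mu> :: "'a measure" and x0 :: 'a
    and A0 c0 C0 \<delta> \<eta> \<beta> \<gamma> s :: real
    and \<A> :: "int \<Rightarrow> 'i set" and z :: "int \<Rightarrow> 'i \<Rightarrow> 'a" and Q :: "int \<Rightarrow> 'i \<Rightarrow> 'a set"
    and j0 N :: nat and K :: "nat \<Rightarrow> 'a \<Rightarrow> 'a \<Rightarrow> complex"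
  assumes "homogeneous_type d A0 \<mu>"
    and "dyadic_points d A0 c0 C0 \<delta> \<A> z"
    and "dyadic_cubes d A0 \<mu> c0 C0 \<delta> \<A> z Q"
    and "1 \<le> j0" "\<delta> ^ j0 \<le> C0 / (2 * A0) ^ 3"
    and "0 < \<eta>" "\<eta> < 1"
    and "exp_IATI d \<mu> \<delta> \<A> z \<eta> K"
    and "1 \<le> N" "reproducing_formula d A0 \<mu> x0 \<delta> \<A> Q j0 \<eta> K N"
    and "0 < \<beta>" "\<beta> < \<eta>" "0 < \<gamma>" "\<gamma> < \<eta>"
    and "0 < s" "s < min \<beta> \<gamma>"
  shows "(\<exists>C::real. 0 < C \<and> (\<forall>f\<in>hoelder_space d \<mu> s.
            fun_distr \<mu> f \<in> besov_space d A0 \<mu> x0 \<delta> \<A> Q j0 \<eta> K N \<beta> \<gamma> s \<and>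
            besov_norm \<mu> \<delta> \<A> Q j0 K N s (fun_distr \<mu> f) \<le> ennreal C * hoelder_norm d \<mu> s f)) \<and>
         (\<exists>C::real. 0 < C \<and> (\<forall>f\<in>besov_space d A0 \<mu> x0 \<delta> \<A> Q j0 \<eta> K N \<beta> \<gamma> s.
            \<exists>g\<in>hoelder_space d \<mu> s.
              (\<forall>\<phi>\<in>test_space0 d A0 \<mu> x0 \<eta> \<beta> \<gamma>. f \<phi> = fun_distr \<mu> g \<phi>) \<and>
              hoelder_norm d \<mu> s g \<le> ennreal C * besov_norm \<mu> \<delta> \<A> Q j0 K N s f))"
proof -
  obtain D where D: "\<And>x r. 0 < r \<Longrightarrow> vol d \<mu> (2 * r) x \<le> D * vol d \<mu> r x"
    using assms(1) by (auto simp: homogeneous_type_def vol_def)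
  interpret dyadic_space d A0 \<mu> D c0 C0 \<delta> \<A> z Q
    by unfold_locales (use assms(1-3) D in auto)
  \<comment> \<open>s < \<beta> < \<eta> < 1; the moment estimate for the exponential kernels relies
    on s \<le> 1.\<close>
  have "s \<le> 1" "s < \<beta>" using assms(6-16) by auto
  then show ?thesis
    using assms(6-16) by (intro conjI hoelder_imp_besov besov_imp_hoelder) auto
qed

end
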